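(* Let $k\ge0$. The theory $\mathsf{HA}+\mathrm{LEM}(\Sigma_k)$ is closed under the independence-of-premise rule: for all formulas $\varphi,\psi$ of the language of $\mathsf{HA}$ and every variable $x$ not free in $\neg\varphi$, if $\mathsf{HA}+\mathrm{LEM}(\Sigma_k)\vdash\neg\varphi\to\exists x\psi$, then $\mathsf{HA}+\mathrm{LEM}(\Sigma_k)\vdash\exists x(\neg\varphi\to\psi)$.
   Context: $\mathsf{HA}$ is intuitionistic first-order arithmetic with function symbols for all primitive recursive functions and logical constants $\forall,\exists,\to,\land,\lor,\perp$ ($\neg\varphi:\equiv\varphi\to\perp$). $\Sigma_0=\Pi_0$ = quantifier-free formulas; $\Sigma_{m+1}$ = formulas $\exists x_1\cdots\exists x_n\varphi$, $\varphi\in\Pi_m$; $\Pi_{m+1}$ = formulas $\forall x_1\cdots\forall x_n\varphi$, $\varphi\in\Sigma_m$. $\mathrm{LEM}(\Sigma_k)$ is the scheme $\varphi\lor\neg\varphi$ for $\varphi\in\Sigma_k$ (free variables allowed). *)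

theory Defs
  imports Main
begin

(* Function symbols: one for every description of a primitive recursive function.  Comp carries
   its arity n explicitly so that it is determined also when the list of inner functions is
   empty; Rec recurses on its first argument. *)
datatype pr =
    Zero
  | Succ
  | Proj nat nat
  | Comp nat pr "pr list"
  | Rec pr pr

primrec arity :: "pr \<Rightarrow> nat" where
  "arity Zero = 0"
| "arity Succ = 1"
| "arity (Proj n i) = n"
| "arity (Comp n f gs) = n"
| "arity (Rec f g) = Suc (arity f)"

fun wf_pr :: "pr \<Rightarrow> bool" where
  "wf_pr Zero \<longleftrightarrow> True"
| "wf_pr Succ \<longleftrightarrow> True"
| "wf_pr (Proj n i) \<longleftrightarrow> i < n"
| "wf_pr (Comp n f gs) \<longleftrightarrow>
     wf_pr f \<and> arity f = length gs \<and> (\<forall>g\<in>set gs. wf_pr g \<and> arity g = n)"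
| "wf_pr (Rec f g) \<longleftrightarrow> wf_pr f \<and> wf_pr g \<and> arity g = Suc (Suc (arity f))"

datatype tm =
    Var nat
  | Fn pr "tm list"

datatype fm =
    Eq tm tm
  | Bot
  | And fm fm
  | Or fm fm
  | Imp fm fm
  | All nat fm
  | Ex nat fm

abbreviation Neg :: "fm \<Rightarrow> fm" where
  "Neg A \<equiv> Imp A Bot"

abbreviation zero :: tm where
  "zero \<equiv> Fn Zero []"

abbreviation suc :: "tm \<Rightarrow> tm" where
  "suc t \<equiv> Fn Succ [t]"

(* The terms and formulas of the language of HA are the elements of tm and fm in which every
   function symbol is applied to as many arguments as its arity prescribes. *)
fun wf_tm :: "tm \<Rightarrow> bool" where
  "wf_tm (Var x) \<longleftrightarrow> True"
| "wf_tm (Fn f ts) \<longleftrightarrow> wf_pr f \<and> length ts = arity f \<and> (\<forall>t\<in>set ts. wf_tm t)"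

fun wf_fm :: "fm \<Rightarrow> bool" where
  "wf_fm (Eq s t) \<longleftrightarrow> wf_tm s \<and> wf_tm t"
| "wf_fm Bot \<longleftrightarrow> True"
| "wf_fm (And A B) \<longleftrightarrow> wf_fm A \<and> wf_fm B"
| "wf_fm (Or A B) \<longleftrightarrow> wf_fm A \<and> wf_fm B"
| "wf_fm (Imp A B) \<longleftrightarrow> wf_fm A \<and> wf_fm B"
| "wf_fm (All x A) \<longleftrightarrow> wf_fm A"
| "wf_fm (Ex x A) \<longleftrightarrow> wf_fm A"

fun fv_tm :: "tm \<Rightarrow> nat set" where
  "fv_tm (Var x) = {x}"
| "fv_tm (Fn f ts) = (\<Union>t\<in>set ts. fv_tm t)"

fun fv :: "fm \<Rightarrow> nat set" where
  "fv (Eq s t) = fv_tm s \<union> fv_tm t"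
| "fv Bot = {}"
| "fv (And A B) = fv A \<union> fv B"
| "fv (Or A B) = fv A \<union> fv B"
| "fv (Imp A B) = fv A \<union> fv B"
| "fv (All x A) = fv A - {x}"
| "fv (Ex x A) = fv A - {x}"

fun subst_tm :: "nat \<Rightarrow> tm \<Rightarrow> tm \<Rightarrow> tm" where
  "subst_tm x t (Var y) = (if y = x then t else Var y)"
| "subst_tm x t (Fn f ts) = Fn f (map (subst_tm x t) ts)"

(* subst x t A replaces the free occurrences of x in A by t without renaming bound variables;
   it is only used under the proviso free_for t x A, which excludes variable capture. *)
fun subst :: "nat \<Rightarrow> tm \<Rightarrow> fm \<Rightarrow> fm" where
  "subst x t (Eq r s) = Eq (subst_tm x t r) (subst_tm x t s)"
| "subst x t Bot = Bot"
| "subst x t (And A B) = And (subst x t A) (subst x t B)"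
| "subst x t (Or A B) = Or (subst x t A) (subst x t B)"
| "subst x t (Imp A B) = Imp (subst x t A) (subst x t B)"
| "subst x t (All y A) = All y (if y = x then A else subst x t A)"
| "subst x t (Ex y A) = Ex y (if y = x then A else subst x t A)"

fun free_for :: "tm \<Rightarrow> nat \<Rightarrow> fm \<Rightarrow> bool" where
  "free_for t x (Eq r s) \<longleftrightarrow> True"
| "free_for t x Bot \<longleftrightarrow> True"
| "free_for t x (And A B) \<longleftrightarrow> free_for t x A \<and> free_for t x B"
| "free_for t x (Or A B) \<longleftrightarrow> free_for t x A \<and> free_for t x B"
| "free_for t x (Imp A B) \<longleftrightarrow> free_for t x A \<and> free_for t x B"
| "free_for t x (All y A) \<longleftrightarrow> x \<notin> fv (All y A) \<or> y \<notin> fv_tm t \<and> free_for t x A"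
| "free_for t x (Ex y A) \<longleftrightarrow> x \<notin> fv (Ex y A) \<or> y \<notin> fv_tm t \<and> free_for t x A"

(* Intuitionistic natural deduction from non-logical axioms T under assumptions G.  The axioms
   are not subject to the eigenvariable conditions: a formula of T with free variables has the
   force of its universal closure.  The wf premises keep derivations inside the language. *)
inductive deriv :: "fm set \<Rightarrow> fm set \<Rightarrow> fm \<Rightarrow> bool" for T :: "fm set" where
  Axiom: "A \<in> T \<Longrightarrow> wf_fm A \<Longrightarrow> deriv T G A"
| Assm: "A \<in> G \<Longrightarrow> wf_fm A \<Longrightarrow> deriv T G A"
| Weaken: "deriv T G A \<Longrightarrow> G \<subseteq> H \<Longrightarrow> deriv T H A"
| BotE: "deriv T G Bot \<Longrightarrow> wf_fm A \<Longrightarrow> deriv T G A"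
| AndI: "deriv T G A \<Longrightarrow> deriv T G B \<Longrightarrow> deriv T G (And A B)"
| AndE1: "deriv T G (And A B) \<Longrightarrow> deriv T G A"
| AndE2: "deriv T G (And A B) \<Longrightarrow> deriv T G B"
| OrI1: "deriv T G A \<Longrightarrow> wf_fm B \<Longrightarrow> deriv T G (Or A B)"
| OrI2: "deriv T G B \<Longrightarrow> wf_fm A \<Longrightarrow> deriv T G (Or A B)"
| OrE: "deriv T G (Or A B) \<Longrightarrow> deriv T (insert A G) C \<Longrightarrow> deriv T (insert B G) C \<Longrightarrow> deriv T G C"
| ImpI: "deriv T (insert A G) B \<Longrightarrow> wf_fm A \<Longrightarrow> deriv T G (Imp A B)"
| ImpE: "deriv T G (Imp A B) \<Longrightarrow> deriv T G A \<Longrightarrow> deriv T G B"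
| AllI: "deriv T G A \<Longrightarrow> \<forall>B\<in>G. x \<notin> fv B \<Longrightarrow> deriv T G (All x A)"
| AllE: "deriv T G (All x A) \<Longrightarrow> wf_tm t \<Longrightarrow> free_for t x A \<Longrightarrow> deriv T G (subst x t A)"
| ExI: "deriv T G (subst x t A) \<Longrightarrow> wf_tm t \<Longrightarrow> wf_fm A \<Longrightarrow> free_for t x A \<Longrightarrow> deriv T G (Ex x A)"
| ExE: "deriv T G (Ex x A) \<Longrightarrow> deriv T (insert A G) C \<Longrightarrow> \<forall>B\<in>G. x \<notin> fv B \<Longrightarrow> x \<notin> fv C
    \<Longrightarrow> deriv T G C"

definition provable :: "fm set \<Rightarrow> fm \<Rightarrow> bool" (infix "\<turnstile>" 50) where
  "T \<turnstile> A \<longleftrightarrow> deriv T {} A"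

inductive_set HA_raw :: "fm set" where
  refl: "Eq t t \<in> HA_raw"
| leibniz: "free_for s x A \<Longrightarrow> free_for t x A
    \<Longrightarrow> Imp (Eq s t) (Imp (subst x s A) (subst x t A)) \<in> HA_raw"
| suc_nonzero: "Neg (Eq (suc t) zero) \<in> HA_raw"
| suc_inj: "Imp (Eq (suc s) (suc t)) (Eq s t) \<in> HA_raw"
| proj: "i < n \<Longrightarrow> length ts = n \<Longrightarrow> Eq (Fn (Proj n i) ts) (ts ! i) \<in> HA_raw"
| comp: "Eq (Fn (Comp n f gs) ts) (Fn f (map (\<lambda>g. Fn g ts) gs)) \<in> HA_raw"
| rec_zero: "Eq (Fn (Rec f g) (zero # ts)) (Fn f ts) \<in> HA_raw"
| rec_suc: "Eq (Fn (Rec f g) (suc t # ts)) (Fn g (t # Fn (Rec f g) (t # ts) # ts)) \<in> HA_raw"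
| ind: "Imp (And (subst x zero A) (All x (Imp A (subst x (suc (Var x)) A)))) (All x A) \<in> HA_raw"

definition HA :: "fm set" where
  "HA = {A \<in> HA_raw. wf_fm A}"

fun qfree :: "fm \<Rightarrow> bool" where
  "qfree (Eq s t) \<longleftrightarrow> True"
| "qfree Bot \<longleftrightarrow> True"
| "qfree (And A B) \<longleftrightarrow> qfree A \<and> qfree B"
| "qfree (Or A B) \<longleftrightarrow> qfree A \<and> qfree B"
| "qfree (Imp A B) \<longleftrightarrow> qfree A \<and> qfree B"
| "qfree (All x A) \<longleftrightarrow> False"
| "qfree (Ex x A) \<longleftrightarrow> False"

(* foldr Ex [x1, ..., xn] A is the formula Ex x1 (... (Ex xn A)); empty blocks are allowed. *)
fun Sigma_fm :: "nat \<Rightarrow> fm set" and Pi_fm :: "nat \<Rightarrow> fm set" where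
  "Sigma_fm 0 = {A. wf_fm A \<and> qfree A}"
| "Sigma_fm (Suc m) = {foldr Ex xs A | xs A. A \<in> Pi_fm m}"
| "Pi_fm 0 = {A. wf_fm A \<and> qfree A}"
| "Pi_fm (Suc m) = {foldr All xs A | xs A. A \<in> Sigma_fm m}"

definition LEM :: "fm set \<Rightarrow> fm set" where
  "LEM C = {Or A (Neg A) | A. A \<in> C}"

end

theory Submission
  imports Defs
begin

text \<open>Write \<open>\<theta>\<close> for \<open>\<not>\<phi>\<close> and \<open>C\<close> for \<open>\<exists>x. \<theta> \<longrightarrow> \<psi>\<close>. In terms of Kripke models one glues a new root
  below the nodes forcing \<open>\<theta>\<close>; forcing at this root is internalised as a translation \<open>A\<^sup>*\<close> in
  which, as in Friedman's translation, \<open>C\<close> plays the part of falsity. Atoms are weakened by \<open>C\<close>,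
  the connectives \<open>\<and>\<close>, \<open>\<or>\<close> and \<open>\<exists>\<close> are left alone, and \<open>(A \<longrightarrow> B)\<^sup>*\<close> is
  \<open>(A\<^sup>* \<longrightarrow> B\<^sup>*) \<and> (C \<or> (\<theta> \<longrightarrow> A \<longrightarrow> B))\<close>, similarly for \<open>\<forall>\<close>. Then \<open>C\<close> implies \<open>A\<^sup>*\<close>, and \<open>A\<^sup>*\<close>
  implies \<open>C \<or> (\<theta> \<longrightarrow> A)\<close>. The translation preserves derivability from HA; it also preserves
  LEM, since for \<open>\<Sigma>\<^sub>k\<close> formulas \<open>A\<^sup>*\<close> is equivalent to \<open>C \<or> A\<close> in the presence of \<open>\<Sigma>\<^sub>k\<close>-LEM.

  If \<open>\<phi>\<^sup>*\<close>, then \<open>C\<close> or \<open>\<theta> \<longrightarrow> \<phi>\<close>; the latter refutes \<open>\<theta>\<close> and hence also yields \<open>C\<close>. So \<open>\<theta>\<^sup>*\<close> holds,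
  whence \<open>\<exists>x. \<psi>\<^sup>*\<close>, whence \<open>\<exists>x. C \<or> (\<theta> \<longrightarrow> \<psi>)\<close>, which is \<open>C\<close>.

  To keep bound variables from capturing the parameters of \<open>\<theta>\<close> and \<open>C\<close>, the translation shifts
  all variables of \<open>A\<close> by a number \<open>N\<close> above those of \<open>C\<close>. At the end the shifted
  parameters are replaced by the original ones and the bound variables are renamed back.\<close>

section \<open>Substitution and derivability\<close>

lemma subst_tm_fresh: "x \<notin> fv_tm r \<Longrightarrow> subst_tm x t r = r"
  by (induction r) (auto intro: map_idI)

lemma subst_fresh: "x \<notin> fv A \<Longrightarrow> subst x t A = A"
  by (induction A) (auto simp: subst_tm_fresh)

lemma free_for_fresh: "x \<notin> fv A \<Longrightarrow> free_for t x A"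
  by (induction A) auto

lemma subst_tm_Var: "subst_tm x (Var x) r = r"
  by (induction r) (auto intro: map_idI)

lemma subst_Var: "subst x (Var x) A = A"
  by (induction A) (auto simp: subst_tm_Var)

lemma free_for_Var: "free_for (Var x) x A"
  by (induction A) auto

lemma wf_subst_tm: "wf_tm r \<Longrightarrow> wf_tm t \<Longrightarrow> wf_tm (subst_tm x t r)"
  by (induction r) auto

lemma wf_subst: "wf_fm A \<Longrightarrow> wf_tm t \<Longrightarrow> wf_fm (subst x t A)"
  by (induction A) (auto simp: wf_subst_tm)

lemma deriv_wf: "deriv T G A \<Longrightarrow> wf_fm A"
  by (induction rule: deriv.induct) (auto simp: wf_subst)

lemma deriv_cut:
  assumes "deriv T G A" "deriv T (insert A G) B"
  shows "deriv T G B"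
  using assms by (meson ImpE ImpI deriv_wf)

lemma deriv_trans:
  assumes "deriv T G A" "deriv T {A} B"
  shows "deriv T G B"
  using assms by (meson Weaken deriv_cut empty_subsetI insert_mono)

lemma deriv_lift: "deriv T {} A \<Longrightarrow> deriv T G A"
  by (rule Weaken) auto

lemma deriv_insert: "deriv T G A \<Longrightarrow> deriv T (insert B G) A"
  by (rule Weaken) auto

lemma deriv_hyp: "wf_fm A \<Longrightarrow> deriv T (insert A G) A"
  by (rule Assm) auto

lemma deriv_Neg_contradiction:
  assumes "wf_fm A"
  shows "deriv T {A, Neg A} Bot"
proof (rule ImpE)
  show "deriv T {A, Neg A} (Neg A)" "deriv T {A, Neg A} A"
    using assms by (auto intro: Assm)
qed

text \<open>Kripke-style introduction rule: the subgoal ranges over all larger contexts that derive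
  the premise, so no step has to track which assumption was inserted. \<open>OrE_ext\<close> does
  the same for case distinctions.\<close>

lemma ImpI_ext:
  assumes "wf_fm A" "\<And>H. G \<subseteq> H \<Longrightarrow> deriv T H A \<Longrightarrow> deriv T H B"
  shows "deriv T G (Imp A B)"
  using assms by (meson ImpI deriv_hyp subset_insertI)

lemma OrE_ext:
  assumes "deriv T G (Or A B)"
    and "\<And>H. G \<subseteq> H \<Longrightarrow> deriv T H A \<Longrightarrow> deriv T H D"
    and "\<And>H. G \<subseteq> H \<Longrightarrow> deriv T H B \<Longrightarrow> deriv T H D"
  shows "deriv T G D"
proof -
  have "wf_fm A" "wf_fm B"
    using deriv_wf[OF assms(1)] by auto
  then show ?thesis
    using assms by (meson OrE deriv_hyp subset_insertI)
qed

lemma AllE_same: "deriv T G (All x A) \<Longrightarrow> deriv T G A"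
  using AllE[of T G x A "Var x"] by (simp add: subst_Var free_for_Var)

lemma ExI_same: "deriv T G A \<Longrightarrow> deriv T G (Ex x A)"
  using ExI[of T G x "Var x" A] deriv_wf[of T G A] by (simp add: subst_Var free_for_Var)

text \<open>Without open assumptions the eigenvariable condition of \<open>AllI\<close> is vacuous,
  so free variables can be generalised and then instantiated.\<close>

lemma deriv_subst:
  assumes "deriv T {} A" "wf_tm t" "free_for t x A"
  shows "deriv T {} (subst x t A)"
  using assms by (intro AllE AllI) auto

lemma deriv_All_mono:
  assumes "wf_fm A" "deriv T {A} B"
  shows "deriv T {All x A} (All x B)"
proof -
  have "deriv T {All x A} A"
    using assms by (intro AllE_same[of _ _ x A] deriv_hyp[of "All x A"]) auto
  then have "deriv T {All x A} B"
    using assms(2) by (rule deriv_trans)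
  then show ?thesis
    by (rule AllI) auto
qed

lemma deriv_Ex_elim:
  assumes "wf_fm A" "deriv T {A} B" "x \<notin> fv B"
  shows "deriv T {Ex x A} B"
proof (rule ExE)
  show "deriv T {Ex x A} (Ex x A)"
    using assms by (intro deriv_hyp) auto
  show "deriv T (insert A {Ex x A}) B"
    using deriv_insert[OF assms(2), of "Ex x A"] by (simp add: insert_commute)
qed (use assms in auto)

lemma deriv_Ex_mono:
  assumes "wf_fm A" "deriv T {A} B"
  shows "deriv T {Ex x A} (Ex x B)"
  using assms by (intro deriv_Ex_elim ExI_same[of T _ B]) auto

lemma deriv_Neg_Ex:
  assumes "wf_fm A"
  shows "deriv T {Neg (Ex x A)} (All x (Neg A))"
proof (rule AllI)
  have "deriv T {A, Neg (Ex x A)} (Ex x A)" "deriv T {A, Neg (Ex x A)} (Neg (Ex x A))"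
    using assms by (auto intro!: ExI_same[of T _ A] intro: Assm)
  then have "deriv T {A, Neg (Ex x A)} Bot"
    by (blast intro: ImpE)
  then show "deriv T {Neg (Ex x A)} (Neg A)"
    using assms by (rule ImpI)
qed auto

section \<open>Renaming\<close>

text \<open>Free variables are renamed by \<open>f\<close>, every bound variable \<open>x\<close> becomes \<open>N + x\<close>. No capture
  occurs as long as the values of \<open>f\<close> at the free variables other than \<open>x\<close> avoid \<open>N + x\<close>.\<close>

fun rn_tm :: "(nat \<Rightarrow> nat) \<Rightarrow> tm \<Rightarrow> tm" where
  "rn_tm f (Var x) = Var (f x)"
| "rn_tm f (Fn g ts) = Fn g (map (rn_tm f) ts)"

fun rn :: "nat \<Rightarrow> (nat \<Rightarrow> nat) \<Rightarrow> fm \<Rightarrow> fm" where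
  "rn N f (Eq s t) = Eq (rn_tm f s) (rn_tm f t)"
| "rn N f Bot = Bot"
| "rn N f (And A B) = And (rn N f A) (rn N f B)"
| "rn N f (Or A B) = Or (rn N f A) (rn N f B)"
| "rn N f (Imp A B) = Imp (rn N f A) (rn N f B)"
| "rn N f (All x A) = All (N + x) (rn N (f(x := N + x)) A)"
| "rn N f (Ex x A) = Ex (N + x) (rn N (f(x := N + x)) A)"

abbreviation sh_tm :: "nat \<Rightarrow> tm \<Rightarrow> tm" where
  "sh_tm N \<equiv> rn_tm ((+) N)"

abbreviation sh :: "nat \<Rightarrow> fm \<Rightarrow> fm" where
  "sh N \<equiv> rn N ((+) N)"

text \<open>The update made under a quantifier does not alter the shift, so \<open>sh N\<close>
  recurses with the same function everywhere.\<close>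

lemma shift_upd [simp]: "((+) N)(x := N + x) = (+) N"
  by auto

lemma wf_rn_tm [simp]: "wf_tm (rn_tm f t) \<longleftrightarrow> wf_tm t"
  by (induction t) auto

lemma wf_rn [simp]: "wf_fm (rn N f A) \<longleftrightarrow> wf_fm A"
  by (induction A arbitrary: f) auto

lemma fv_rn_tm: "fv_tm (rn_tm f t) = f ` fv_tm t"
  by (induction t) auto

text \<open>Equality can fail: an unrestricted \<open>f\<close> may send a free variable to some
  \<open>N + x\<close> that is captured.\<close>

lemma fv_rn: "fv (rn N f A) \<subseteq> f ` fv A"
proof (induction A arbitrary: f)
  case (All x A)
  have "(f(x := N + x)) ` fv A - {N + x} \<subseteq> f ` (fv A - {x})"
    by auto
  then show ?case
    using All[of "f(x := N + x)"] unfolding rn.simps fv.simps by blast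
next
  case (Ex x A)
  have "(f(x := N + x)) ` fv A - {N + x} \<subseteq> f ` (fv A - {x})"
    by auto
  then show ?case
    using Ex[of "f(x := N + x)"] unfolding rn.simps fv.simps by blast
qed (auto simp: fv_rn_tm, blast+)

lemma shift_notin_fv_sh: "x \<notin> fv A \<Longrightarrow> N + x \<notin> fv (sh N A)"
  using fv_rn[of N "(+) N" A] by auto

lemma sh_tm_subst: "sh_tm N (subst_tm x t r) = subst_tm (N + x) (sh_tm N t) (sh_tm N r)"
  by (induction r) auto

lemma sh_subst: "sh N (subst x t A) = subst (N + x) (sh_tm N t) (sh N A)"
  by (induction A) (auto simp: sh_tm_subst)

lemma free_for_sh: "free_for t x A \<Longrightarrow> free_for (sh_tm N t) (N + x) (sh N A)"
proof (induction A)
  case (All y A)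
  then show ?case using shift_notin_fv_sh[of x "All y A" N] by (auto simp: fv_rn_tm)
next
  case (Ex y A)
  then show ?case using shift_notin_fv_sh[of x "Ex y A" N] by (auto simp: fv_rn_tm)
qed auto

section \<open>Updates of a renaming as substitutions, and change of bound names\<close>

fun vars :: "fm \<Rightarrow> nat set" where
  "vars (Eq s t) = fv_tm s \<union> fv_tm t"
| "vars Bot = {}"
| "vars (And A B) = vars A \<union> vars B"
| "vars (Or A B) = vars A \<union> vars B"
| "vars (Imp A B) = vars A \<union> vars B"
| "vars (All x A) = insert x (vars A)"
| "vars (Ex x A) = insert x (vars A)"

lemma finite_fv_tm: "finite (fv_tm t)"
  by (induction t) auto

lemma finite_vars: "finite (vars A)"
  by (induction A) (auto simp: finite_fv_tm)

lemma fv_subset_vars: "fv A \<subseteq> vars A"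
  by (induction A) auto

lemma subst_rn_tm:
  assumes "\<And>u. u \<in> fv_tm t \<Longrightarrow> u \<noteq> v \<Longrightarrow> f u \<noteq> f v"
  shows "subst_tm (f v) (Var w) (rn_tm f t) = rn_tm (f(v := w)) t"
  using assms by (induction t) auto

text \<open>Below \<open>N\<close>, such an \<open>f\<close> is injective because \<open>u\<close>
  and \<open>N + u\<close> agree modulo \<open>N\<close>. Hence no free variable other than
  \<open>v\<close> is sent to \<open>f v\<close>.\<close>

lemma rn_fresh:
  assumes "vars A \<subseteq> {..<N}" "\<And>u. f u \<in> {u, N + u}" "v < N" "v \<notin> fv A"
  shows "f v \<notin> fv (rn N f A)"
proof
  assume "f v \<in> fv (rn N f A)"
  then obtain u where u: "u \<in> fv A" "f u = f v"
    using fv_rn[of N f A] by force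
  then have "u < N" "u \<noteq> v"
    using assms fv_subset_vars[of A] by auto
  then show False
    using u(2) assms(2)[of u] assms(2)[of v] assms(3) by auto
qed

text \<open>By the same injectivity, free occurrences of \<open>f v\<close> mark exactly those of
  \<open>v\<close>. Under a quantifier over \<open>v\<close> the update at \<open>v\<close> is
  overwritten and there is nothing to substitute; under any other quantifier the two updates
  commute.\<close>

lemma subst_rn:
  assumes "vars A \<subseteq> {..<N}" "\<And>u. f u \<in> {u, N + u}" "v < N"
  shows "subst (f v) (Var w) (rn N f A) = rn N (f(v := w)) A"
  using assms(1,2)
proof (induction A arbitrary: f)
  case (Eq s t)
  have "f u \<noteq> f v" if "u < N" "u \<noteq> v" for u
    using Eq(2)[of u] Eq(2)[of v] that assms(3) by auto
  then show ?case
    using Eq(1) subst_rn_tm[of s v f w] subst_rn_tm[of t v f w]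
    by (auto simp del: fun_upd_apply)
next
  case (All x A)
  show ?case
  proof (cases "x = v")
    case True
    have "f v \<notin> fv (rn N f (All v A))"
      using All(2,3) assms(3) by (intro rn_fresh) auto
    from subst_fresh[OF this, of "Var w"] show ?thesis
      using True by (simp del: fun_upd_apply)
  next
    case False
    have c: "(f(x := N + x)) u \<in> {u, N + u}" for u
      using All(3) by simp
    from False have "f v \<noteq> N + x"
      using All(3)[of v] All(2) assms(3) by auto
    moreover have "subst (f v) (Var w) (rn N (f(x := N + x)) A) = rn N (f(x := N + x, v := w)) A"
      using All(1)[OF _ c] All(2) fun_upd_other[OF not_sym[OF False], of f] by (simp del: fun_upd_apply)
    ultimately show ?thesis
      using False fun_upd_twist[of x v f "N + x" w] by (simp del: fun_upd_apply)
  qed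
next
  case (Ex x A)
  show ?case
  proof (cases "x = v")
    case True
    have "f v \<notin> fv (rn N f (Ex v A))"
      using Ex(2,3) assms(3) by (intro rn_fresh) auto
    from subst_fresh[OF this, of "Var w"] show ?thesis
      using True by (simp del: fun_upd_apply)
  next
    case False
    have c: "(f(x := N + x)) u \<in> {u, N + u}" for u
      using Ex(3) by simp
    from False have "f v \<noteq> N + x"
      using Ex(3)[of v] Ex(2) assms(3) by auto
    moreover have "subst (f v) (Var w) (rn N (f(x := N + x)) A) = rn N (f(x := N + x, v := w)) A"
      using Ex(1)[OF _ c] Ex(2) fun_upd_other[OF not_sym[OF False], of f] by (simp del: fun_upd_apply)
    ultimately show ?thesis
      using False fun_upd_twist[of x v f "N + x" w] by (simp del: fun_upd_apply)
  qed
qed auto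

text \<open>Bound variables have the form \<open>N + x\<close>. This differs from \<open>v\<close>,
  which is below \<open>N\<close>, and from \<open>N + v\<close> unless \<open>x = v\<close>, where
  \<open>v\<close> is not free.\<close>

lemma free_for_rn:
  assumes "vars A \<subseteq> {..<N}" "\<And>u. f u \<in> {u, N + u}" "v < N" "w \<in> {v, N + v}"
  shows "free_for (Var w) (f v) (rn N f A)"
  using assms(1,2)
proof (induction A arbitrary: f)
  case (All x A)
  show ?case
  proof (cases "x = v")
    case True
    have "f v \<notin> fv (rn N f (All v A))"
      using All(2,3) assms(3) by (intro rn_fresh) auto
    from free_for_fresh[OF this] show ?thesis
      unfolding True .
  next
    case False
    have c: "(f(x := N + x)) u \<in> {u, N + u}" for u
      using All(3) by simp
    have "free_for (Var w) (f v) (rn N (f(x := N + x)) A)"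
      using All(1)[OF _ c] All(2) fun_upd_other[OF not_sym[OF False], of f] by (simp del: fun_upd_apply)
    then show ?thesis
      using All(2) False assms(3,4) by auto
  qed
next
  case (Ex x A)
  show ?case
  proof (cases "x = v")
    case True
    have "f v \<notin> fv (rn N f (Ex v A))"
      using Ex(2,3) assms(3) by (intro rn_fresh) auto
    from free_for_fresh[OF this] show ?thesis
      unfolding True .
  next
    case False
    have c: "(f(x := N + x)) u \<in> {u, N + u}" for u
      using Ex(3) by simp
    have "free_for (Var w) (f v) (rn N (f(x := N + x)) A)"
      using Ex(1)[OF _ c] Ex(2) fun_upd_other[OF not_sym[OF False], of f] by (simp del: fun_upd_apply)
    then show ?thesis
      using Ex(2) False assms(3,4) by auto
  qed
qed auto

text \<open>Since \<open>f\<close> fixes every variable of \<open>A\<close>, the renamed formula is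
  an alpha-variant. The induction keeps \<open>f\<close> fixed: below a quantifier the renaming is
  \<open>g\<close>, and exchanging \<open>N + x\<close> and \<open>x\<close> by
  \<open>subst_rn\<close> leads between \<open>g\<close> and \<open>f\<close>.\<close>

lemma deriv_rename_bound:
  assumes "wf_fm A" "vars A \<subseteq> {..<N}" "\<And>u. f u \<in> {u, N + u}" "\<And>u. u < N \<Longrightarrow> f u = u"
  shows "deriv T {rn N f A} A \<and> deriv T {A} (rn N f A)"
  using assms(1,2)
proof (induction A)
  case (Eq s t)
  have "rn_tm f r = r" if "fv_tm r \<subseteq> {..<N}" for r
    using that assms(4) by (induction r) (auto intro!: map_idI)
  then show ?case
    using Eq by (auto intro!: deriv_hyp)
next
  case Bot
  then show ?case by (auto intro: deriv_hyp)
next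
  case (And A B)
  have "deriv T {And X Y} (And X' Y')" if "deriv T {X} X'" "deriv T {Y} Y'" "wf_fm X" "wf_fm Y"
    for X Y X' Y'
  proof -
    have "deriv T {And X Y} (And X Y)"
      using that by (intro deriv_hyp) auto
    then show ?thesis
      using that by (meson AndE1 AndE2 AndI deriv_trans)
  qed
  then show ?case
    using And by auto
next
  case (Or A B)
  have "deriv T {Or X Y} (Or X' Y')" if "deriv T {X} X'" "deriv T {Y} Y'" "wf_fm X" "wf_fm Y"
    for X Y X' Y'
  proof -
    have "deriv T {Or X Y} (Or X Y)"
      using that by (intro deriv_hyp) auto
    then show ?thesis
      using that by (elim OrE_ext) (meson OrI1 OrI2 deriv_trans deriv_wf)+
  qed
  then show ?case
    using Or by auto
next
  case (Imp A B)
  have "deriv T {Imp X Y} (Imp X' Y')"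
    if "deriv T {X'} X" "deriv T {Y} Y'" "wf_fm X" "wf_fm Y" "wf_fm X'" for X Y X' Y'
  proof (rule ImpI_ext)
    fix H assume H: "{Imp X Y} \<subseteq> H" "deriv T H X'"
    then have "deriv T H (Imp X Y)"
      using that by (intro Assm) auto
    then show "deriv T H Y'"
      using that H(2) by (meson ImpE deriv_trans)
  qed fact
  then show ?case
    using Imp by auto
next
  case (All x A)
  define g where "g = f(x := N + x)"
  have g: "\<And>u. g u \<in> {u, N + u}" "g x = N + x" "g(x := x) = f"
    using assms(3,4) All(3) by (auto simp: g_def)
  have IH: "deriv T {rn N f A} A" "deriv T {A} (rn N f A)"
    using All by auto
  have x: "x < N" and A: "vars A \<subseteq> {..<N}" and wf: "wf_fm A"
    using All by auto
  have f_x: "f x = x"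
    using assms(4) x .
  have fresh: "x \<notin> fv (rn N f (All x A))"
    using rn_fresh[OF All(3) assms(3) x] f_x by simp
  have "deriv T {All (N + x) (rn N g A)} (subst (N + x) (Var x) (rn N g A))"
    using free_for_rn[OF A g(1) x, where w = x] g(2) wf by (intro AllE deriv_hyp) auto
  then have "deriv T {All (N + x) (rn N g A)} A"
    using subst_rn[OF A g(1) x, where w = x] g IH(1) by (simp add: deriv_trans)
  moreover have "x \<notin> fv (All (N + x) (rn N g A))"
    using fresh by (simp add: g_def)
  ultimately have 1: "deriv T {rn N f (All x A)} (All x A)"
    by (auto simp: g_def intro: AllI)
  have "deriv T {All x A} (All x (rn N f A))"
    using wf IH by (intro deriv_All_mono)
  then have "deriv T {All x A} (subst x (Var (N + x)) (rn N f A))"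
    using free_for_rn[OF A assms(3) x, where w = "N + x"] f_x by (intro AllE) auto
  then have "deriv T {All x A} (rn N g A)"
    using subst_rn[OF A assms(3) x, where w = "N + x"] f_x by (simp add: g_def)
  moreover have "N + x \<notin> fv (All x A)"
    using fv_subset_vars[of A] A by auto
  ultimately have "deriv T {All x A} (rn N f (All x A))"
    by (auto simp: g_def intro: AllI)
  with 1 show ?case by blast
next
  case (Ex x A)
  define g where "g = f(x := N + x)"
  have g: "\<And>u. g u \<in> {u, N + u}" "g x = N + x" "g(x := x) = f"
    using assms(3,4) Ex(3) by (auto simp: g_def)
  have IH: "deriv T {rn N f A} A" "deriv T {A} (rn N f A)"
    using Ex by auto
  have x: "x < N" and A: "vars A \<subseteq> {..<N}" and wf: "wf_fm A"
    using Ex by auto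
  have f_x: "f x = x"
    using assms(4) x .
  have fresh: "x \<notin> fv (rn N f (Ex x A))"
    using rn_fresh[OF Ex(3) assms(3) x] f_x by simp
  have wf_Ex: "wf_fm (Ex (N + x) (rn N g A))" "wf_fm (Ex x A)"
    using wf by auto
  have "deriv T {rn N g A} (Ex x (rn N f A))"
    using free_for_rn[OF A assms(3) x, where w = "N + x"] f_x wf
      subst_rn[OF A assms(3) x, where w = "N + x"]
    by (intro ExI[where t = "Var (N + x)"]) (auto simp: g_def intro: deriv_hyp)
  then have "deriv T {rn N g A} (Ex x A)"
    using deriv_Ex_mono[OF _ IH(1)] wf by (auto intro: deriv_trans)
  moreover have "N + x \<notin> fv (Ex x A)"
    using fv_subset_vars[of A] A by auto
  ultimately have 1: "deriv T {Ex (N + x) (rn N g A)} (Ex x A)"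
    using ExE[OF deriv_hyp[OF wf_Ex(1)], of T "{}" "Ex x A"]
      Weaken[of T "{rn N g A}" "Ex x A" "{rn N g A, Ex (N + x) (rn N g A)}"] by auto
  have "deriv T {A} (subst (N + x) (Var x) (rn N g A))"
    using IH(2) subst_rn[OF A g(1) x, where w = x] g by simp
  then have "deriv T {A} (Ex (N + x) (rn N g A))"
    using free_for_rn[OF A g(1) x, where w = x] g(2) wf by (intro ExI) auto
  then have "deriv T {Ex x A} (Ex (N + x) (rn N g A))"
    using ExE[OF deriv_hyp[OF wf_Ex(2)], of T "{}" "Ex (N + x) (rn N g A)"] fresh
      Weaken[of T "{A}" "Ex (N + x) (rn N g A)" "{A, Ex x A}"] by (auto simp: g_def)
  with 1 show ?case by (simp add: g_def)
qed

section \<open>Strong decidability in the arithmetical hierarchy\<close>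

abbreviation (input) HAL :: "nat \<Rightarrow> fm set" where
  "HAL k \<equiv> HA \<union> LEM (Sigma_fm k)"

section \<open>Invariance of HA with LEM under the shift\<close>

lemma sh_HA_raw: "A \<in> HA_raw \<Longrightarrow> sh N A \<in> HA_raw"
proof (induction rule: HA_raw.induct)
  case (leibniz s x A t)
  then show ?case
    by (simp add: sh_subst free_for_sh HA_raw.leibniz)
next
  case (ind x A)
  show ?case
    using HA_raw.ind[of "N + x" "sh N A"] by (simp add: sh_subst)
next
  case (comp n f gs ts)
  show ?case
    using HA_raw.comp[of n f gs "map (sh_tm N) ts"] by (simp add: comp_def)
next
  case (proj i n ts)
  then show ?case
    using HA_raw.proj[of i n "map (sh_tm N) ts"] by simp
qed (auto intro: HA_raw.intros)

lemma qfree_rn [simp]: "qfree (rn N f A) \<longleftrightarrow> qfree A"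
  by (induction A arbitrary: f) auto

lemma sh_foldr_Ex: "sh N (foldr Ex xs A) = foldr Ex (map ((+) N) xs) (sh N A)"
  by (induction xs) auto

lemma sh_foldr_All: "sh N (foldr All xs A) = foldr All (map ((+) N) xs) (sh N A)"
  by (induction xs) auto

lemma sh_Sigma_Pi:
  "(A \<in> Sigma_fm m \<longrightarrow> sh N A \<in> Sigma_fm m) \<and> (A \<in> Pi_fm m \<longrightarrow> sh N A \<in> Pi_fm m)"
proof (induction m arbitrary: A)
  case (Suc m)
  then show ?case
    by (auto simp: sh_foldr_Ex sh_foldr_All) blast+
qed auto

lemma sh_HAL: "A \<in> HAL k \<Longrightarrow> sh N A \<in> HAL k"
  using sh_HA_raw sh_Sigma_Pi by (auto simp: HA_def LEM_def)

text \<open>The axioms are closed under the shift, and the shift is injective, so substitutions and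
  eigenvariable conditions survive and a derivation can be shifted rule by rule.\<close>

lemma deriv_sh: "deriv (HAL k) G A \<Longrightarrow> deriv (HAL k) (sh N ` G) (sh N A)"
proof (induction rule: deriv.induct)
  case (Axiom A G)
  then show ?case
    using deriv.Axiom[OF sh_HAL] by simp
next
  case (Weaken G A H)
  then show ?case
    by (meson deriv.Weaken image_mono)
next
  case (OrE G A B C)
  then show ?case
    by (auto intro: deriv.OrE)
next
  case (AllI G A x)
  then show ?case
    by (auto intro!: deriv.AllI simp: shift_notin_fv_sh)
next
  case (AllE G x A t)
  then show ?case
    by (auto intro!: deriv.AllE simp: sh_subst free_for_sh)
next
  case (ExI G x t A)
  then show ?case
    by (auto intro!: deriv.ExI[where t = "sh_tm N t"] simp: sh_subst free_for_sh)
next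
  case (ExE G x A C)
  then show ?case
    by (auto intro!: deriv.ExE[of _ _ "N + x" "sh N A"] simp: shift_notin_fv_sh)
next
  case (ImpE G A B)
  then show ?case
    by (auto intro: deriv.ImpE)
next
  case (AndE1 G A B)
  then show ?case
    by (auto intro: deriv.AndE1)
next
  case (AndE2 G A B)
  then show ?case
    by (auto intro: deriv.AndE2)
qed (auto intro: Assm BotE AndI OrI1 OrI2 ImpI)

lemma Pi_subset_Sigma_Suc: "Pi_fm m \<subseteq> Sigma_fm (Suc m)"
  by (auto intro: exI[of _ "[]"])

lemma Sigma_subset_Pi_Suc: "Sigma_fm m \<subseteq> Pi_fm (Suc m)"
  by (auto intro: exI[of _ "[]"])

text \<open>Both inclusions go through one induction, because each class is built from the other one
  a level below.\<close>

lemma Sigma_Pi_subset_Suc: "Sigma_fm m \<subseteq> Sigma_fm (Suc m) \<and> Pi_fm m \<subseteq> Pi_fm (Suc m)"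
proof (induction m)
  case 0
  show ?case using Pi_subset_Sigma_Suc[of 0] Sigma_subset_Pi_Suc[of 0] by simp
next
  case (Suc m)
  then show ?case
    unfolding Sigma_fm.simps(2) Pi_fm.simps(2) by blast
qed

lemma Sigma_mono: "m \<le> n \<Longrightarrow> Sigma_fm m \<subseteq> Sigma_fm n"
  by (rule lift_Suc_mono_le[of Sigma_fm]) (auto simp del: Sigma_fm.simps simp: Sigma_Pi_subset_Suc)

lemma wf_foldr_Ex [simp]: "wf_fm (foldr Ex xs A) \<longleftrightarrow> wf_fm A"
  by (induction xs) auto

lemma wf_foldr_All [simp]: "wf_fm (foldr All xs A) \<longleftrightarrow> wf_fm A"
  by (induction xs) auto

lemma wf_Sigma_Pi: "(A \<in> Sigma_fm m \<longrightarrow> wf_fm A) \<and> (A \<in> Pi_fm m \<longrightarrow> wf_fm A)"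
  by (induction m arbitrary: A) auto

lemma Sigma_decidable:
  assumes "A \<in> Sigma_fm m" "m \<le> k"
  shows "deriv (HAL k) G (Or A (Neg A))"
  using assms Sigma_mono[of m k] wf_Sigma_Pi[of A m] by (intro Axiom) (auto simp: LEM_def)

text \<open>Only meant for prenex formulas: other connectives are negated without being decomposed.\<close>

fun dual :: "fm \<Rightarrow> fm" where
  "dual (All x A) = Ex x (dual A)"
| "dual (Ex x A) = All x (dual A)"
| "dual A = Neg A"

lemma wf_dual [simp]: "wf_fm (dual A) \<longleftrightarrow> wf_fm A"
  by (induction A) auto

lemma dual_qfree: "qfree A \<Longrightarrow> dual A = Neg A"
  by (cases A) auto

lemma dual_foldr_Ex: "dual (foldr Ex xs A) = foldr All xs (dual A)"
  by (induction xs) auto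

lemma dual_foldr_All: "dual (foldr All xs A) = foldr Ex xs (dual A)"
  by (induction xs) auto

lemma dual_Sigma_Pi:
  "(A \<in> Sigma_fm m \<longrightarrow> dual A \<in> Pi_fm m) \<and> (A \<in> Pi_fm m \<longrightarrow> dual A \<in> Sigma_fm m)"
proof (induction m arbitrary: A)
  case (Suc m)
  then show ?case
    by (auto simp: dual_foldr_Ex dual_foldr_All) blast+
qed (auto simp: dual_qfree)

lemma dual_contradiction: "wf_fm A \<Longrightarrow> deriv T {A, dual A} Bot"
proof (induction A)
  case (All x A)
  let ?G = "{All x A, Ex x (dual A)}"
  have "deriv T (insert (dual A) ?G) (dual A)"
    using All by (intro deriv_hyp) auto
  moreover have "deriv T (insert (dual A) ?G) A"
    using All by (intro AllE_same[of _ _ x A] Assm[of "All x A"]) auto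
  ultimately have "deriv T (insert (dual A) ?G) Bot"
    using Weaken[OF All(1), of "insert A (insert (dual A) ?G)"] All(2)
    by (intro deriv_cut[of T "insert (dual A) ?G" A Bot]) auto
  moreover have "deriv T ?G (Ex x (dual A))"
    using All by (intro Assm) auto
  ultimately show ?case
    by (auto intro: ExE)
next
  case (Ex x A)
  let ?G = "{Ex x A, All x (dual A)}"
  have "deriv T (insert A ?G) (dual A)"
    using Ex by (intro AllE_same[of _ _ x "dual A"] Assm[of "All x (dual A)"]) auto
  then have "deriv T (insert A ?G) Bot"
    using Weaken[OF Ex(1), of "insert (dual A) (insert A ?G)"] Ex(2)
    by (intro deriv_cut[of T "insert A ?G" "dual A" Bot]) auto
  moreover have "deriv T ?G (Ex x A)"
    using Ex by (intro Assm) auto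
  ultimately show ?case
    by (auto intro: ExE)
qed (auto simp: deriv_Neg_contradiction)

lemma dual_cases:
  assumes "wf_fm A" "deriv T G A" "deriv T G (dual A)"
  shows "deriv T G Bot"
proof -
  have "deriv T (insert A (insert (dual A) G)) Bot"
    by (rule Weaken[OF dual_contradiction[OF assms(1)]]) auto
  moreover have "deriv T (insert (dual A) G) A"
    by (rule Weaken[OF assms(2)]) auto
  ultimately show ?thesis
    using assms(3) by (meson deriv_cut)
qed

text \<open>The first law follows intuitionistically from \<open>nd\<close>; the second needs the
  decision of the existential formula, whose negative case is refuted by the first law.\<close>

lemma dual_Ex_laws:
  assumes wf: "wf_fm B" and nd: "deriv T {Neg B} (dual B)"
    and dec: "deriv T {} (Or (Ex x B) (Neg (Ex x B)))"
  shows "deriv T {Neg (Ex x B)} (dual (Ex x B))" "deriv T {Neg (dual (Ex x B))} (Ex x B)"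
proof -
  have "deriv T {All x (Neg B)} (dual (Ex x B))"
    using deriv_All_mono[OF _ nd] wf by simp
  then show 1: "deriv T {Neg (Ex x B)} (dual (Ex x B))"
    using deriv_Neg_Ex[OF wf] by (rule deriv_trans[rotated])
  show "deriv T {Neg (dual (Ex x B))} (Ex x B)"
  proof (rule OrE_ext[OF deriv_lift[OF dec]])
    fix H assume H: "{Neg (dual (Ex x B))} \<subseteq> H" "deriv T H (Neg (Ex x B))"
    have "deriv T H (dual (Ex x B))"
      using H(2) 1 by (rule deriv_trans)
    moreover have "deriv T H (Neg (dual (Ex x B)))"
      using H(1) wf by (intro Assm) auto
    ultimately show "deriv T H (Ex x B)"
      using wf by (meson BotE ImpE wf_fm.simps(7))
  qed
qed

text \<open>The roles are exchanged: the second law is intuitionistic, and the first needs a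
  decision, namely that of the dual.\<close>

lemma dual_All_laws:
  assumes wf: "wf_fm B" and dd: "deriv T {Neg (dual B)} B"
    and dec: "deriv T {} (Or (dual (All x B)) (Neg (dual (All x B))))"
  shows "deriv T {Neg (All x B)} (dual (All x B))" "deriv T {Neg (dual (All x B))} (All x B)"
proof -
  have "deriv T {All x (Neg (dual B))} (All x B)"
    using deriv_All_mono[OF _ dd] wf by simp
  then show 1: "deriv T {Neg (dual (All x B))} (All x B)"
    using deriv_Neg_Ex[of "dual B" T x] wf by (auto intro: deriv_trans)
  show "deriv T {Neg (All x B)} (dual (All x B))"
  proof (rule OrE_ext[OF deriv_lift[OF dec]])
    fix H assume H: "{Neg (All x B)} \<subseteq> H" "deriv T H (Neg (dual (All x B)))"
    have "deriv T H (All x B)"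
      using H(2) 1 by (rule deriv_trans)
    moreover have "deriv T H (Neg (All x B))"
      using H(1) wf by (intro Assm) auto
    ultimately show "deriv T H (dual (All x B))"
      using wf by (meson BotE ImpE wf_dual wf_fm.simps(6))
  qed
qed

text \<open>Outer induction on the level, inner induction on the quantifier block. LEM is applied to
  the formula itself on the \<open>Sigma_fm\<close> side and to its dual on the \<open>Pi_fm\<close>
  side, so that it always concerns a formula of \<open>Sigma_fm (Suc m)\<close>.\<close>

lemma dual_laws:
  assumes "m \<le> k" "A \<in> Sigma_fm m \<or> A \<in> Pi_fm m"
  shows "deriv (HAL k) {Neg A} (dual A) \<and> deriv (HAL k) {Neg (dual A)} A"
  using assms
proof (induction m arbitrary: A)
  case 0
  then have A: "wf_fm A" "qfree A" "A \<in> Sigma_fm 0"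
    by auto
  have "deriv (HAL k) {Neg (Neg A)} A"
  proof (rule OrE_ext[OF Sigma_decidable[OF A(3)]])
    fix H assume "{Neg (Neg A)} \<subseteq> H" "deriv (HAL k) H (Neg A)"
    then show "deriv (HAL k) H A"
      using A(1) Assm[of "Neg (Neg A)" H] by (auto intro: BotE ImpE)
  qed auto
  then show ?case
    using A by (auto simp: dual_qfree intro: deriv_hyp)
next
  case (Suc m)
  have Ex: "deriv (HAL k) {Neg D} (dual D) \<and> deriv (HAL k) {Neg (dual D)} D"
    if "B \<in> Pi_fm m" "D = foldr Ex xs B" for B D xs
    using that(2)
  proof (induction xs arbitrary: D)
    case Nil
    then show ?case using Suc that by auto
  next
    case (Cons x xs)
    have "D \<in> Sigma_fm (Suc m)"
      using Cons(2) that(1) unfolding Sigma_fm.simps(2) by blast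
    from Sigma_decidable[OF this Suc(2)] show ?case
      using Cons dual_Ex_laws[of "foldr Ex xs B" "HAL k" x] that(1) wf_Sigma_Pi[of B m] by auto
  qed
  have All: "deriv (HAL k) {Neg D} (dual D) \<and> deriv (HAL k) {Neg (dual D)} D"
    if "B \<in> Sigma_fm m" "D = foldr All xs B" for B D xs
    using that(2)
  proof (induction xs arbitrary: D)
    case Nil
    then show ?case using Suc that by auto
  next
    case (Cons x xs)
    have "D \<in> Pi_fm (Suc m)"
      using Cons(2) that(1) unfolding Pi_fm.simps(2) by blast
    then have "dual D \<in> Sigma_fm (Suc m)"
      using dual_Sigma_Pi by blast
    from Sigma_decidable[OF this Suc(2)] show ?case
      using Cons dual_All_laws[of "foldr All xs B" "HAL k" x] that(1) wf_Sigma_Pi[of B m] by auto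
  qed
  show ?case
    using Suc(3) Ex All unfolding Sigma_fm.simps(2) Pi_fm.simps(2) by blast
qed

text \<open>Stronger than excluded middle for \<open>A\<close>: a universal formula either holds or
  has a counterexample. This witness is what the translation of universal formulas requires.\<close>

lemma Pi_decidable:
  assumes "A \<in> Pi_fm m" "m \<le> k"
  shows "deriv (HAL k) G (Or (dual A) A)"
proof (rule OrE_ext)
  show "deriv (HAL k) G (Or (dual A) (Neg (dual A)))"
    using assms dual_Sigma_Pi Sigma_decidable by blast
  have wf: "wf_fm A"
    using assms wf_Sigma_Pi by blast
  fix H
  show "deriv (HAL k) H (Or (dual A) A)" if "deriv (HAL k) H (dual A)"
    using that wf by (rule OrI1)
  show "deriv (HAL k) H (Or (dual A) A)" if "deriv (HAL k) H (Neg (dual A))"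
    using that wf deriv_trans[OF that] dual_laws[OF assms(2)] assms(1) by (auto intro: OrI2)
qed

section \<open>The glueing translation\<close>

locale glueing =
  fixes k N :: nat and \<theta> C :: fm
  assumes wf_\<theta>: "wf_fm \<theta>" and wf_C: "wf_fm C"
    and fv_\<theta>: "fv \<theta> \<subseteq> {..<N}" and fv_C: "fv C \<subseteq> {..<N}"
begin

abbreviation T :: "fm set" where
  "T \<equiv> HAL k"

text \<open>Up to \<open>C\<close>, this says that \<open>A\<close> holds at every node forcing
  \<open>\<theta>\<close>, that is, everywhere above the new root.\<close>

definition cl :: "fm \<Rightarrow> fm" where
  "cl A = Or C (Imp \<theta> A)"

text \<open>Forcing an implication or a universal formula at the root concerns both the root and the
  nodes above it; these are the two conjuncts. The other connectives are decided at the root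
  alone.\<close>

fun star :: "fm \<Rightarrow> fm" where
  "star (Eq s t) = Or C (sh N (Eq s t))"
| "star Bot = C"
| "star (And A B) = And (star A) (star B)"
| "star (Or A B) = Or (star A) (star B)"
| "star (Imp A B) = And (Imp (star A) (star B)) (cl (sh N (Imp A B)))"
| "star (All x A) = And (All (N + x) (star A)) (cl (sh N (All x A)))"
| "star (Ex x A) = Ex (N + x) (star A)"

lemma wf_cl [simp]: "wf_fm (cl A) \<longleftrightarrow> wf_fm A"
  by (simp add: cl_def wf_\<theta> wf_C)

lemma wf_star: "wf_fm A \<Longrightarrow> wf_fm (star A)"
  by (induction A) (auto simp: wf_C)

lemma shift_fresh [simp]: "N + x \<notin> fv \<theta>" "N + x \<notin> fv C"
  using fv_\<theta> fv_C by auto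

lemma fv_cl: "N + x \<notin> fv A \<Longrightarrow> N + x \<notin> fv (cl A)"
  by (simp add: cl_def)

lemma shift_notin_fv_star: "x \<notin> fv A \<Longrightarrow> N + x \<notin> fv (star A)"
proof (induction A)
  case (Eq s t)
  then show ?case
    using shift_notin_fv_sh[of x "Eq s t" N] by simp
next
  case (Imp A B)
  then show ?case
    using fv_cl[OF shift_notin_fv_sh[of x "Imp A B" N]] by simp
next
  case (All y A)
  then show ?case
    using fv_cl[OF shift_notin_fv_sh[of x "All y A" N]] by auto
qed auto

lemma subst_cl: "subst (N + x) t (cl A) = cl (subst (N + x) t A)"
  by (simp add: cl_def subst_fresh)

lemma free_for_cl: "free_for t (N + x) A \<Longrightarrow> free_for t (N + x) (cl A)"
  by (simp add: cl_def free_for_fresh)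

text \<open>\<open>C\<close> and \<open>\<theta>\<close> have no free variable of the form
  \<open>N + x\<close>, so the substitution only reaches the shifted parts. The quantifier rules,
  Leibniz and induction rest on this.\<close>

lemma star_subst: "star (subst x t A) = subst (N + x) (sh_tm N t) (star A)"
proof (induction A)
  case (Eq s r)
  then show ?case
    by (simp add: sh_tm_subst subst_fresh)
next
  case (Imp A B)
  then show ?case
    using sh_subst[of N x t "Imp A B"] by (simp add: subst_cl)
next
  case (All y A)
  then show ?case
    using sh_subst[of N x t "All y A"] by (auto simp: subst_cl)
qed (auto simp: subst_fresh)

lemma free_for_star: "free_for t x A \<Longrightarrow> free_for (sh_tm N t) (N + x) (star A)"
proof (induction A)
  case (Imp A B)
  then show ?case
    using free_for_cl[OF free_for_sh[of t x "Imp A B" N]] by simp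
next
  case (All y A)
  have "free_for (sh_tm N t) (N + x) (All (N + y) (star A))"
  proof (cases "x \<in> fv (All y A)")
    case True
    then show ?thesis
      using All by (auto simp: fv_rn_tm)
  next
    case False
    then show ?thesis
      using shift_notin_fv_star[of x A] by auto
  qed
  then show ?case
    using free_for_cl[OF free_for_sh[OF All(2), of N]] by simp
next
  case (Ex y A)
  show ?case
  proof (cases "x \<in> fv (Ex y A)")
    case True
    then show ?thesis
      using Ex by (auto simp: fv_rn_tm)
  next
    case False
    then show ?thesis
      using shift_notin_fv_star[of x A] by auto
  qed
qed (auto simp: free_for_fresh)

section \<open>The modality \<open>cl\<close>, ex falso from \<open>C\<close>, and
  persistence\<close>

lemma cl_C: "deriv S G C \<Longrightarrow> wf_fm A \<Longrightarrow> deriv S G (cl A)"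
  unfolding cl_def by (rule OrI1) (auto simp: wf_\<theta>)

lemma cl_Imp_\<theta>: "deriv S G (Imp \<theta> A) \<Longrightarrow> deriv S G (cl A)"
  unfolding cl_def by (rule OrI2) (auto simp: wf_C)

lemma cl_I: "deriv S G A \<Longrightarrow> deriv S G (cl A)"
  by (rule cl_Imp_\<theta>, rule ImpI) (auto simp: wf_\<theta> deriv_insert)

lemma cl_mp:
  assumes "deriv S G (cl (Imp A B))" "deriv S G (cl A)"
  shows "deriv S G (cl B)"
proof -
  have wf: "wf_fm B"
    using deriv_wf[OF assms(1)] by simp
  show ?thesis
  proof (rule OrE_ext[OF assms(1)[unfolded cl_def]])
    fix H assume H: "G \<subseteq> H" "deriv S H (Imp \<theta> (Imp A B))"
    have "deriv S H (Or C (Imp \<theta> A))"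
      using assms(2) H(1) unfolding cl_def by (rule Weaken)
    then show "deriv S H (cl B)"
    proof (rule OrE_ext)
      fix K assume K: "H \<subseteq> K" "deriv S K (Imp \<theta> A)"
      have "deriv S K (Imp \<theta> B)"
      proof (rule ImpI_ext[OF wf_\<theta>])
        fix L assume L: "K \<subseteq> L" "deriv S L \<theta>"
        have "deriv S L (Imp \<theta> A)" "deriv S L (Imp \<theta> (Imp A B))"
          using Weaken[OF K(2) L(1)] Weaken[OF H(2) subset_trans[OF K(1) L(1)]] by auto
        then show "deriv S L B"
          using L(2) by (meson ImpE)
      qed
      then show "deriv S K (cl B)"
        by (rule cl_Imp_\<theta>)
    qed (rule cl_C[OF _ wf])
  qed (rule cl_C[OF _ wf])
qed

lemma cl_mono:
  assumes "deriv S G (cl A)" "deriv S {A} B"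
  shows "deriv S G (cl B)"
proof -
  have "wf_fm A"
    using deriv_wf[OF assms(1)] by simp
  then have "deriv S {} (Imp A B)"
    using assms(2) by (intro ImpI)
  then show ?thesis
    using assms(1) by (meson cl_I cl_mp deriv_lift)
qed

text \<open>Ex falso for the translation, as \<open>star Bot\<close> is \<open>C\<close>. The
  universal case may generalise because \<open>N + x\<close> is not free in
  \<open>C\<close>.\<close>

lemma C_imp_star: "wf_fm A \<Longrightarrow> deriv S {C} (star A)"
proof (induction A)
  case (Imp A B)
  have "deriv S {star A, C} (star B)"
    using Imp by (intro deriv_insert[of S "{C}"]) auto
  then show ?case
    using Imp by (auto intro!: AndI ImpI cl_C deriv_hyp wf_star wf_C)
next
  case (All x A)
  then show ?case
    by (auto intro!: AndI AllI cl_C deriv_hyp wf_C)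
next
  case (Ex x A)
  then show ?case
    by (auto intro!: ExI_same[of S _ "star A"])
qed (auto intro!: deriv_hyp AndI OrI1 wf_star simp: wf_C)

text \<open>Persistence from the root upwards: \<open>Imp\<close> and \<open>All\<close> carry it as
  second conjunct, and the remaining connectives inherit it through \<open>cl_mono\<close> and
  \<open>cl_mp\<close>.\<close>

lemma star_imp_cl:
  "wf_fm A \<Longrightarrow> deriv S G (star A) \<Longrightarrow> deriv S G (cl (sh N A))"
proof (induction A arbitrary: G)
  case (Eq s t)
  have "wf_fm (sh N (Eq s t))"
    using Eq by simp
  show ?case
    using Eq(2)[unfolded star.simps]
  proof (rule OrE_ext)
    show "deriv S H (cl (sh N (Eq s t)))" if "deriv S H C" for H
      using that \<open>wf_fm (sh N (Eq s t))\<close> by (rule cl_C)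
  qed (rule cl_I)
next
  case Bot
  then show ?case
    by (auto intro: cl_C)
next
  case (And A B)
  have "deriv S {sh N B, sh N A} (And (sh N A) (sh N B))"
    using And.prems by (intro AndI Assm) auto
  then have "deriv S {sh N A} (Imp (sh N B) (And (sh N A) (sh N B)))"
    using And.prems by (intro ImpI) auto
  moreover have "deriv S G (star A)" "deriv S G (star B)"
    using And.prems AndE1 AndE2 unfolding star.simps by blast+
  then have "deriv S G (cl (sh N A))" "deriv S G (cl (sh N B))"
    using And.IH And.prems by auto
  ultimately show ?case
    using cl_mono cl_mp by (metis rn.simps(3))
next
  case (Or A B)
  have wf: "wf_fm (sh N A)" "wf_fm (sh N B)"
    using Or.prems by auto
  show ?case
    using Or.prems(2)[unfolded star.simps]
  proof (rule OrE_ext)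
    fix H
    show "deriv S H (cl (sh N (Or A B)))" if "deriv S H (star A)"
      using cl_mono[of S H "sh N A"] Or.IH(1)[OF _ that] Or.prems OrI1[OF deriv_hyp[OF wf(1)] wf(2)]
      by auto
    show "deriv S H (cl (sh N (Or A B)))" if "deriv S H (star B)"
      using cl_mono[of S H "sh N B"] Or.IH(2)[OF _ that] Or.prems OrI2[OF deriv_hyp[OF wf(2)] wf(1)]
      by auto
  qed
next
  case (Imp A B)
  then show ?case
    by (auto dest: AndE2)
next
  case (All x A)
  then show ?case
    by (auto dest: AndE2)
next
  case (Ex x A)
  have wf: "wf_fm A" "wf_fm (star A)"
    using Ex wf_star by auto
  have "deriv S {star A} (cl (sh N A))"
    using Ex.IH wf by (auto intro: deriv_hyp)
  moreover have "deriv S {sh N A} (Ex (N + x) (sh N A))"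
    using wf by (auto intro!: ExI_same[of S _ "sh N A"] deriv_hyp)
  ultimately have "deriv S {star A} (cl (Ex (N + x) (sh N A)))"
    by (rule cl_mono)
  then have "deriv S {Ex (N + x) (star A)} (cl (Ex (N + x) (sh N A)))"
    using wf fv_cl[of x "Ex (N + x) (sh N A)"]
    by (intro deriv_Ex_elim) auto
  then show ?case
    using Ex.prems(2) by (auto intro: deriv_trans)
qed

text \<open>The assumptions are discharged one by one into implications and recovered by
  \<open>cl_mp\<close> and \<open>star_imp_cl\<close>, hence the finite context.\<close>

lemma cl_context:
  assumes "finite G" "\<forall>B\<in>G. wf_fm B" "deriv S (sh N ` G) A"
  shows "deriv S (star ` G) (cl A)"
  using assms
proof (induction G arbitrary: A rule: finite_induct)
  case empty
  then show ?case
    by (auto intro: cl_I)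
next
  case (insert B G)
  have "deriv S (sh N ` G) (Imp (sh N B) A)"
    using insert.prems by (intro ImpI) auto
  then have "deriv S (star ` G) (cl (Imp (sh N B) A))"
    using insert by auto
  then have "deriv S (star ` insert B G) (cl (Imp (sh N B) A))"
    by (rule Weaken) auto
  moreover have "deriv S (star ` insert B G) (cl (sh N B))"
    using insert.prems by (intro star_imp_cl Assm wf_star) auto
  ultimately show ?case
    by (rule cl_mp)
qed

lemma star_Imp_intro:
  assumes "deriv S G (sh N (Imp A B))" "deriv S (insert (star A) G) (star B)"
  shows "deriv S G (star (Imp A B))"
proof -
  have "wf_fm (star A)"
    using deriv_wf[OF assms(1)] by (auto intro: wf_star)
  then show ?thesis
    using assms by (auto intro!: AndI ImpI cl_I)
qed

lemma star_ImpD: "deriv S G (star (Imp A B)) \<Longrightarrow> deriv S G (Imp (star A) (star B))"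
  by (auto dest: AndE1)

lemma star_AllD: "deriv S G (star (All x A)) \<Longrightarrow> deriv S G (All (N + x) (star A))"
  by (auto dest: AndE1)

lemma star_HA:
  assumes "A \<in> HA"
  shows "deriv T {} (star A)"
proof -
  have wf: "wf_fm A"
    using assms by (simp add: HA_def)
  \<comment> \<open>The shifted axiom is again an axiom; it supplies the second conjuncts
    below.\<close>
  have ax: "deriv T G (sh N A)" for G
    using wf sh_HAL[of A k N] assms by (intro Axiom) auto
  have "A \<in> HA_raw"
    using assms by (simp add: HA_def)
  then show ?thesis
  proof (cases rule: HA_raw.cases)
    case (leibniz s x B t)
    have wfs: "wf_tm s" "wf_tm t" "wf_fm (subst x s B)" "wf_fm (subst x t B)"
      using wf leibniz by auto
    have wf_star_B: "wf_fm (star (subst x s B))" "wf_fm (star (subst x t B))"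
      using wfs wf_star by auto
    let ?E = "sh N (Eq s t)" and ?F = "Imp (subst x s B) (subst x t B)"
    have "deriv T {Or C ?E} (Or C ?E)"
      using wfs wf_C by (intro deriv_hyp) auto
    then have "deriv T {Or C ?E} (star ?F)"
    proof (rule OrE_ext)
      fix H
      show "deriv T H (star ?F)" if "deriv T H C"
        using that C_imp_star[of ?F] wfs by (intro deriv_trans[OF that]) auto
      assume E: "deriv T H ?E"
      \<comment> \<open>By \<open>star_subst\<close> this is the Leibniz axiom for the formula
        \<open>star B\<close> and the variable \<open>N + x\<close>.\<close>
      have "Imp ?E (Imp (star (subst x s B)) (star (subst x t B))) \<in> HA_raw"
        using HA_raw.leibniz[OF free_for_star[OF leibniz(2)] free_for_star[OF leibniz(3)]]
        by (simp add: star_subst)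
      then have "Imp ?E (Imp (star (subst x s B)) (star (subst x t B))) \<in> HA"
        using wf_star_B wfs by (simp add: HA_def)
      then have "deriv T H (Imp ?E (Imp (star (subst x s B)) (star (subst x t B))))"
        using wf_star_B wfs by (intro Axiom) auto
      from ImpE[OF this E] have 1: "deriv T H (Imp (star (subst x s B)) (star (subst x t B)))" .
      have "deriv T H (Imp ?E (sh N ?F))"
        using ax leibniz by simp
      from cl_I[OF ImpE[OF this E]] 1 show "deriv T H (star ?F)"
        by (auto intro: AndI)
    qed
    then show ?thesis
      using star_Imp_intro[of T "{}" "Eq s t" ?F] ax unfolding leibniz by simp
  next
    case (suc_nonzero t)
    let ?E = "sh N (Eq (suc t) zero)"
    have "deriv T {Or C ?E} (Or C ?E)"
      using wf suc_nonzero wf_C by (intro deriv_hyp) auto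
    then have "deriv T {Or C ?E} C"
    proof (rule OrE_ext)
      fix H
      assume E: "deriv T H ?E"
      have "deriv T H (Imp ?E Bot)"
        using ax suc_nonzero by simp
      from BotE[OF ImpE[OF this E] wf_C] show "deriv T H C" .
    qed
    then show ?thesis
      using star_Imp_intro[of T "{}" "Eq (suc t) zero" Bot] ax unfolding suc_nonzero by simp
  next
    case (suc_inj s t)
    let ?E = "sh N (Eq (suc s) (suc t))" and ?F = "sh N (Eq s t)"
    have wf_F: "wf_fm ?F"
      using wf suc_inj by simp
    have "deriv T {Or C ?E} (Or C ?E)"
      using wf suc_inj wf_C by (intro deriv_hyp) auto
    then have "deriv T {Or C ?E} (Or C ?F)"
    proof (rule OrE_ext)
      fix H
      show "deriv T H (Or C ?F)" if "deriv T H C"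
        using that wf_F by (rule OrI1)
      assume E: "deriv T H ?E"
      have "deriv T H (Imp ?E ?F)"
        using ax suc_inj by simp
      from OrI2[OF ImpE[OF this E] wf_C] show "deriv T H (Or C ?F)" .
    qed
    then show ?thesis
      using star_Imp_intro[of T "{}" "Eq (suc s) (suc t)" "Eq s t"] ax unfolding suc_inj by simp
  next
    case (ind x B)
    let ?X = "And (subst x zero B) (All x (Imp B (subst x (suc (Var x)) B)))"
    let ?I = "Imp B (subst x (suc (Var x)) B)"
    let ?Y = "All (N + x) (Imp (star B) (star (subst x (suc (Var x)) B)))"
    have wfs: "wf_fm B" "wf_fm ?X" "wf_fm (star ?I)"
      using wf ind wf_star[of ?I] by auto
    have X: "deriv T {star ?X} (star ?X)"
      using wf_star[OF wfs(2)] by (rule deriv_hyp)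
    then have X12: "deriv T {star ?X} (star (subst x zero B))" "deriv T {star ?X} (star (All x ?I))"
      using AndE1 AndE2 star.simps(3) by metis+
    have "deriv T {All (N + x) (star ?I)} ?Y"
      using wfs(3) star_ImpD[OF deriv_hyp[OF wfs(3)]] by (rule deriv_All_mono)
    with star_AllD[OF X12(2)] have Y: "deriv T {star ?X} ?Y"
      by (rule deriv_trans)
    from X12(1) have 1: "deriv T {star ?X} (And (star (subst x zero B)) ?Y)"
      using Y by (rule AndI)
    \<comment> \<open>By \<open>star_subst\<close> this is induction on \<open>N + x\<close> for
      \<open>star B\<close>.\<close>
    have "Imp (And (star (subst x zero B)) ?Y) (All (N + x) (star B)) \<in> HA_raw"
      using HA_raw.ind[of "N + x" "star B"] by (simp add: star_subst)
    moreover have "wf_fm (Imp (And (star (subst x zero B)) ?Y) (All (N + x) (star B)))"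
      using wfs deriv_wf[OF 1] by (simp add: wf_star)
    ultimately have "deriv T {star ?X} (Imp (And (star (subst x zero B)) ?Y) (All (N + x) (star B)))"
      by (intro Axiom) (auto simp: HA_def)
    from ImpE[OF this 1] have "deriv T {star ?X} (All (N + x) (star B))" .
    moreover have "deriv T {star ?X} (cl (Imp (sh N ?X) (sh N (All x B))))"
      using cl_I[OF ax] ind by simp
    then have "deriv T {star ?X} (cl (sh N (All x B)))"
      using star_imp_cl[OF wfs(2) X] by (rule cl_mp)
    ultimately have "deriv T {star ?X} (star (All x B))"
      by (auto intro: AndI)
    then show ?thesis
      using star_Imp_intro[of T "{}" ?X "All x B"] ax unfolding ind by simp
  qed (use ax wf_C in \<open>auto intro!: OrI2\<close>)
qed

text \<open>Intuitionistically, a universally quantified \<open>Or C A\<close> need not give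
  \<open>C\<close> or the universal closure of \<open>A\<close>. Here \<open>dec\<close> offers
  either that closure or a counterexample, at which \<open>star A\<close> leaves only
  \<open>C\<close>.\<close>

lemma star_All_collapse:
  assumes wf: "wf_fm A" and dec: "deriv T {} (Or (dual (sh N (All x A))) (sh N (All x A)))"
    and IH: "deriv T {star A} (Or C (sh N A))"
  shows "deriv T {star (All x A)} (Or C (sh N (All x A)))"
proof (rule OrE[OF deriv_lift[OF dec]])
  have wf_star_A: "wf_fm (star (All x A))"
    using wf by (intro wf_star) auto
  show "deriv T {sh N (All x A), star (All x A)} (Or C (sh N (All x A)))"
    using wf wf_C by (intro OrI2 deriv_hyp) auto
  let ?G = "{dual (sh N (All x A)), star (All x A)}"
  show "deriv T ?G (Or C (sh N (All x A)))"
  proof (rule ExE)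
    show "deriv T ?G (Ex (N + x) (dual (sh N A)))"
      using wf by (intro Assm) auto
    have "deriv T (insert (dual (sh N A)) ?G) (star (All x A))"
      using wf_star_A by (intro Assm) auto
    from AllE_same[OF AndE1[OF this[unfolded star.simps]]]
    have "deriv T (insert (dual (sh N A)) ?G) (star A)"
      by simp
    from deriv_trans[OF this IH] show "deriv T (insert (dual (sh N A)) ?G) (Or C (sh N (All x A)))"
    proof (rule OrE_ext)
      fix H
      show "deriv T H (Or C (sh N (All x A)))" if "deriv T H C"
        using that wf by (intro OrI1) auto
      assume H: "insert (dual (sh N A)) ?G \<subseteq> H" "deriv T H (sh N A)"
      have "deriv T H (dual (sh N A))"
        using H(1) wf by (intro Assm) auto
      from dual_cases[OF _ H(2) this] show "deriv T H (Or C (sh N (All x A)))"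
        using BotE[of T H "Or C (sh N (All x A))"] wf wf_C by simp
    qed
    show "\<forall>B\<in>?G. N + x \<notin> fv B"
      using shift_notin_fv_star[of x "All x A"] by auto
    show "N + x \<notin> fv (Or C (sh N (All x A)))"
      by auto
  qed
qed

lemma star_qfree_collapse:
  assumes "wf_fm A" "qfree A"
  shows "deriv T {sh N A} (star A) \<and> deriv T {star A} (Or C (sh N A))"
  using assms
proof (induction A)
  case (Eq s t)
  then show ?case
    using wf_C by (auto intro!: OrI2 deriv_hyp)
next
  case Bot
  then show ?case
    using wf_C BotE[OF deriv_hyp[of Bot], of C T "{}"] OrI1[OF deriv_hyp[OF wf_C], of Bot T "{}"]
    by auto
next
  case (And A B)
  have wf: "wf_fm (sh N A)" "wf_fm (sh N B)" "wf_fm (star A)" "wf_fm (star B)"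
    using And.prems wf_star by auto
  have IH: "deriv T {sh N A} (star A)" "deriv T {star A} (Or C (sh N A))"
    "deriv T {sh N B} (star B)" "deriv T {star B} (Or C (sh N B))"
    using And by auto
  have h: "deriv T {And (sh N A) (sh N B)} (And (sh N A) (sh N B))"
    using wf by (intro deriv_hyp) auto
  have g: "deriv T {And (star A) (star B)} (And (star A) (star B))"
    using wf by (intro deriv_hyp) auto
  have 1: "deriv T {And (sh N A) (sh N B)} (And (star A) (star B))"
    using AndI[OF deriv_trans[OF AndE1[OF h] IH(1)] deriv_trans[OF AndE2[OF h] IH(3)]] .
  have 2: "deriv T {And (star A) (star B)} (Or C (And (sh N A) (sh N B)))"
  proof (rule OrE_ext[OF deriv_trans[OF AndE1[OF g] IH(2)]])
    fix H
    show "deriv T H (Or C (And (sh N A) (sh N B)))" if "deriv T H C"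
      using that wf by (intro OrI1) auto
    assume H: "{And (star A) (star B)} \<subseteq> H" "deriv T H (sh N A)"
    show "deriv T H (Or C (And (sh N A) (sh N B)))"
    proof (rule OrE_ext[OF deriv_trans[OF AndE2[OF Weaken[OF g H(1)]] IH(4)]])
      fix K
      show "deriv T K (Or C (And (sh N A) (sh N B)))" if "deriv T K C"
        using that wf by (intro OrI1) auto
      assume "H \<subseteq> K" "deriv T K (sh N B)"
      then show "deriv T K (Or C (And (sh N A) (sh N B)))"
        using Weaken[OF H(2)] wf_C by (intro OrI2 AndI) auto
    qed
  qed
  show ?case
    using 1 2 by simp
next
  case (Or A B)
  have wf: "wf_fm (sh N A)" "wf_fm (sh N B)" "wf_fm (star A)" "wf_fm (star B)"
    using Or.prems wf_star by auto
  have IH: "deriv T {sh N A} (star A)" "deriv T {star A} (Or C (sh N A))"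
    "deriv T {sh N B} (star B)" "deriv T {star B} (Or C (sh N B))"
    using Or by auto
  have h: "deriv T {Or (sh N A) (sh N B)} (Or (sh N A) (sh N B))"
    using wf by (intro deriv_hyp) auto
  have g: "deriv T {Or (star A) (star B)} (Or (star A) (star B))"
    using wf by (intro deriv_hyp) auto
  have 1: "deriv T {Or (sh N A) (sh N B)} (Or (star A) (star B))"
    using OrI1[OF deriv_trans[OF _ IH(1)] wf(4)] OrI2[OF deriv_trans[OF _ IH(3)] wf(3)]
    by (rule OrE_ext[OF h])
  have 2: "deriv T {Or (star A) (star B)} (Or C (Or (sh N A) (sh N B)))"
  proof (rule OrE_ext[OF g])
    fix H
    have C: "deriv T K (Or C (Or (sh N A) (sh N B)))" if "deriv T K C" for K
      using that wf by (intro OrI1) auto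
    show "deriv T H (Or C (Or (sh N A) (sh N B)))" if "deriv T H (star A)"
      by (rule OrE_ext[OF deriv_trans[OF that IH(2)] C OrI2[OF OrI1[OF _ wf(2)] wf_C]])
    show "deriv T H (Or C (Or (sh N A) (sh N B)))" if "deriv T H (star B)"
      by (rule OrE_ext[OF deriv_trans[OF that IH(4)] C OrI2[OF OrI2[OF _ wf(1)] wf_C]])
  qed
  show ?case
    using 1 2 by simp
next
  case (Imp A B)
  have wf: "wf_fm (sh N A)" "wf_fm (sh N B)" "wf_fm (star A)" "wf_fm (star B)" "wf_fm B"
    using Imp.prems wf_star by auto
  have IH: "deriv T {sh N A} (star A)" "deriv T {star A} (Or C (sh N A))"
    "deriv T {sh N B} (star B)" "deriv T {star B} (Or C (sh N B))"
    using Imp by auto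
  let ?I = "Imp (sh N A) (sh N B)"
  have h: "deriv T {?I} ?I"
    using wf by (intro deriv_hyp) auto
  have "deriv T {star A, ?I} (star B)"
  proof (rule OrE_ext)
    show "deriv T {star A, ?I} (Or C (sh N A))"
      using deriv_trans[OF deriv_hyp IH(2)] wf by simp
    fix H
    show "deriv T H (star B)" if "deriv T H C"
      using deriv_trans[OF that C_imp_star[OF wf(5)]] .
    assume H: "{star A, ?I} \<subseteq> H" "deriv T H (sh N A)"
    have "deriv T H ?I"
      using H(1) wf by (intro Assm) auto
    from deriv_trans[OF ImpE[OF this H(2)] IH(3)] show "deriv T H (star B)" .
  qed
  then have 1: "deriv T {sh N (Imp A B)} (star (Imp A B))"
    using star_Imp_intro[of T "{sh N (Imp A B)}" A B] h by simp
  \<comment> \<open>To pull \<open>C\<close> out of the conclusion of an implication, its premise is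
    decided; being quantifier-free, it is covered by LEM for every \<open>k\<close>.\<close>
  have "sh N A \<in> Sigma_fm 0"
    using Imp.prems by simp
  from Sigma_decidable[OF this] have "deriv T {star (Imp A B)} (Or (sh N A) (Neg (sh N A)))"
    by simp
  then have 2: "deriv T {star (Imp A B)} (Or C ?I)"
  proof (rule OrE_ext)
    fix H assume H: "{star (Imp A B)} \<subseteq> H"
    have g: "deriv T H (star (Imp A B))"
      using H wf_star[OF Imp.prems(1)] by (intro Assm) auto
    show "deriv T H (Or C ?I)" if A: "deriv T H (sh N A)"
    proof (rule OrE_ext)
      show "deriv T H (Or C (sh N B))"
        using deriv_trans[OF ImpE[OF AndE1[OF g[unfolded star.simps]] deriv_trans[OF A IH(1)]] IH(4)] .
      fix K
      show "deriv T K (Or C ?I)" if "deriv T K C"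
        using that wf by (intro OrI1) auto
      show "deriv T K (Or C ?I)" if "deriv T K (sh N B)"
        using OrI2[OF ImpI[OF deriv_insert[OF that] wf(1)] wf_C] .
    qed
    show "deriv T H (Or C ?I)" if A: "deriv T H (Neg (sh N A))"
    proof (rule OrI2[OF ImpI_ext[OF wf(1)] wf_C])
      fix K assume "H \<subseteq> K" "deriv T K (sh N A)"
      from ImpE[OF Weaken[OF A this(1)] this(2)] show "deriv T K (sh N B)"
        using wf(2) by (rule BotE)
    qed
  qed
  show ?case
    using 1 2 by simp
qed auto

text \<open>\<open>C\<close> moves out of an existential quantifier because \<open>N + x\<close> is
  not free in it; out of a universal one it moves by \<open>Pi_decidable\<close>, available up to
  level \<open>k\<close>.\<close>

lemma star_collapse:
  assumes "m \<le> k" "A \<in> Sigma_fm m \<or> A \<in> Pi_fm m"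
  shows "deriv T {sh N A} (star A) \<and> deriv T {star A} (Or C (sh N A))"
  using assms
proof (induction m arbitrary: A)
  case 0
  then show ?case
    using star_qfree_collapse by auto
next
  case (Suc m)
  have Ex: "deriv T {sh N D} (star D) \<and> deriv T {star D} (Or C (sh N D))"
    if "B \<in> Pi_fm m" "D = foldr Ex xs B" for B D xs
    using that(2)
  proof (induction xs arbitrary: D)
    case Nil
    then show ?case using Suc that by auto
  next
    case (Cons x xs)
    let ?F = "foldr Ex xs B"
    have wf: "wf_fm (sh N ?F)" "wf_fm (star ?F)"
      using wf_Sigma_Pi[of B m] that(1) by (auto intro: wf_star)
    have IH: "deriv T {sh N ?F} (star ?F)" "deriv T {star ?F} (Or C (sh N ?F))"
      using Cons(1)[of ?F] by auto
    have "deriv T {star ?F} (Or C (Ex (N + x) (sh N ?F)))"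
    proof (rule OrE_ext[OF IH(2)])
      fix H
      show "deriv T H (Or C (Ex (N + x) (sh N ?F)))" if "deriv T H C"
        using that wf by (intro OrI1) auto
      show "deriv T H (Or C (Ex (N + x) (sh N ?F)))" if "deriv T H (sh N ?F)"
        using OrI2[OF ExI_same[OF that] wf_C] .
    qed
    then have "deriv T {Ex (N + x) (star ?F)} (Or C (Ex (N + x) (sh N ?F)))"
      using wf by (intro deriv_Ex_elim) auto
    then show ?case
      using Cons(2) deriv_Ex_mono[OF wf(1) IH(1)] by simp
  qed
  have All: "deriv T {sh N D} (star D) \<and> deriv T {star D} (Or C (sh N D))"
    if "B \<in> Sigma_fm m" "D = foldr All xs B" for B D xs
    using that(2)
  proof (induction xs arbitrary: D)
    case Nil
    then show ?case using Suc that by auto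
  next
    case (Cons x xs)
    let ?F = "foldr All xs B"
    have wf: "wf_fm ?F" "wf_fm (sh N ?F)" "wf_fm (star ?F)"
      using wf_Sigma_Pi[of B m] that(1) by (auto intro: wf_star)
    have IH: "deriv T {sh N ?F} (star ?F)" "deriv T {star ?F} (Or C (sh N ?F))"
      using Cons(1)[of ?F] by auto
    have "D \<in> Pi_fm (Suc m)"
      using Cons(2) that(1) unfolding Pi_fm.simps(2) by blast
    then have "sh N D \<in> Pi_fm (Suc m)"
      using sh_Sigma_Pi by blast
    from Pi_decidable[OF this Suc(2)]
    have "deriv T {} (Or (dual (sh N (All x ?F))) (sh N (All x ?F)))"
      using Cons(2) by simp
    from star_All_collapse[OF wf(1) this IH(2)]
    have "deriv T {star D} (Or C (sh N D))"
      using Cons(2) by simp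
    moreover have "deriv T {sh N D} (cl (sh N D))"
      using Cons(2) wf by (intro cl_I deriv_hyp) auto
    then have "deriv T {sh N D} (star D)"
      using Cons(2) deriv_All_mono[OF wf(2) IH(1), of "N + x"] by (auto intro: AndI)
    ultimately show ?case
      by blast
  qed
  show ?case
    using Suc(3) Ex All unfolding Sigma_fm.simps(2) Pi_fm.simps(2) by blast
qed

text \<open>Decide the shifted formula. If it is false, \<open>star A\<close> collapses to
  \<open>C\<close>, which is \<open>star Bot\<close>, and so the translated negation holds.\<close>

lemma star_LEM:
  assumes "A \<in> Sigma_fm k"
  shows "deriv T {} (star (Or A (Neg A)))"
proof -
  have wf: "wf_fm A" "wf_fm (star A)"
    using assms wf_Sigma_Pi wf_star by blast+
  have collapse: "deriv T {sh N A} (star A)" "deriv T {star A} (Or C (sh N A))"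
    using star_collapse[of k A] assms by auto
  have "sh N A \<in> Sigma_fm k"
    using assms sh_Sigma_Pi by blast
  from Sigma_decidable[OF this] have "deriv T {} (Or (sh N A) (Neg (sh N A)))"
    by simp
  then have "deriv T {} (Or (star A) (star (Neg A)))"
  proof (rule OrE_ext)
    fix H
    show "deriv T H (Or (star A) (star (Neg A)))" if "deriv T H (sh N A)"
      using deriv_trans[OF that collapse(1)] wf wf_star[of "Neg A"] by (intro OrI1) auto
    assume neg: "deriv T H (Neg (sh N A))"
    have "deriv T (insert (star A) H) C"
    proof (rule OrE_ext)
      show "deriv T (insert (star A) H) (Or C (sh N A))"
        using deriv_trans[OF deriv_hyp[OF wf(2)] collapse(2)] .
      fix K assume K: "insert (star A) H \<subseteq> K" "deriv T K (sh N A)"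
      then show "deriv T K C"
        using BotE[OF ImpE[OF Weaken[OF neg] K(2)] wf_C] by blast
    qed
    then have "deriv T H (star (Neg A))"
      using star_Imp_intro[of T H A Bot] neg by simp
    then show "deriv T H (Or (star A) (star (Neg A)))"
      using wf(2) by (rule OrI2)
  qed
  then show ?thesis
    by simp
qed

lemma star_sound:
  assumes "deriv T G A" "finite G" "\<forall>B\<in>G. wf_fm B"
  shows "deriv T (star ` G) (star A)"
  using assms
proof (induction rule: deriv.induct)
  case (Axiom A G)
  then have "deriv T {} (star A)"
    using star_HA star_LEM by (auto simp: LEM_def)
  then show ?case
    by (rule deriv_lift)
next
  case (Assm A G)
  then show ?case
    by (intro deriv.Assm wf_star) auto
next
  case (Weaken G A H)
  then show ?case
    by (meson deriv.Weaken finite_subset image_mono subsetD)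
next
  case (BotE G A)
  then show ?case
    using deriv_trans C_imp_star by auto
next
  case (AndI G A B)
  then show ?case
    by (auto intro: deriv.AndI)
next
  case (AndE1 G A B)
  then show ?case
    by (auto intro: deriv.AndE1)
next
  case (AndE2 G A B)
  then show ?case
    by (auto intro: deriv.AndE2)
next
  case (OrI1 G A B)
  then show ?case
    by (auto intro: deriv.OrI1 wf_star)
next
  case (OrI2 G B A)
  then show ?case
    by (auto intro: deriv.OrI2 wf_star)
next
  case (OrE G A B D)
  have "wf_fm A" "wf_fm B"
    using deriv_wf[OF OrE(1)] by auto
  then show ?case
    using OrE by (auto intro: deriv.OrE)
next
  case (ImpI A G B)
  \<comment> \<open>The second conjunct comes from the original derivation, shifted and then moved
    to the translated context.\<close>
  then have "deriv T (star ` G) (cl (sh N (Imp A B)))"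
    by (intro cl_context deriv_sh deriv.ImpI) auto
  then show ?case
    using ImpI by (auto intro!: deriv.AndI deriv.ImpI wf_star)
next
  case (ImpE G A B)
  then have "deriv T (star ` G) (Imp (star A) (star B))" "deriv T (star ` G) (star A)"
    by (auto intro: deriv.AndE1)
  then show ?case
    by (rule deriv.ImpE)
next
  case (AllI G A x)
  then have "deriv T (star ` G) (cl (sh N (All x A)))"
    by (intro cl_context deriv_sh deriv.AllI) auto
  then show ?case
    using AllI by (auto intro!: deriv.AndI deriv.AllI simp: shift_notin_fv_star)
next
  case (AllE G x A t)
  then have "deriv T (star ` G) (All (N + x) (star A))"
    by (auto intro: deriv.AndE1)
  then have "deriv T (star ` G) (subst (N + x) (sh_tm N t) (star A))"
    using AllE by (intro deriv.AllE free_for_star) auto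
  then show ?case
    by (simp add: star_subst)
next
  case (ExI G x t A)
  then have "deriv T (star ` G) (Ex (N + x) (star A))"
    by (intro deriv.ExI[of _ _ _ "sh_tm N t"] free_for_star wf_star) (auto simp: star_subst)
  then show ?case
    by simp
next
  case (ExE G x A D)
  have "wf_fm A"
    using deriv_wf[OF ExE(1)] by auto
  then show ?case
    using ExE by (auto intro!: deriv.ExE[of _ _ "N + x" "star A"] simp: shift_notin_fv_star)
qed

end

section \<open>Independence of premise\<close>

text \<open>The shift also moves the free variables of \<open>\<theta>\<close>; the two assumed
  implications bridge the gap until it is undone. The conclusion is a disjunction because
  \<open>star \<psi>\<close> yields either \<open>C\<close> or a shifted witness.\<close>

lemma ip_shifted:
  assumes \<theta>: "\<theta> = Neg \<phi>" and C: "C = Ex x (Imp \<theta> \<psi>)" and x: "x \<notin> fv \<theta>"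
    and "glueing N \<theta> C" and ip: "deriv (HAL k) {} (Imp \<theta> (Ex x \<psi>))"
  shows "deriv (HAL k) {Imp (sh N \<theta>) \<theta>, Imp \<theta> (sh N \<theta>)} (Or C (sh N C))"
proof -
  interpret glueing k N \<theta> C
    by fact
  let ?G = "{Imp (sh N \<theta>) \<theta>, Imp \<theta> (sh N \<theta>)}"
  have wf: "wf_fm \<phi>" "wf_fm \<psi>" "wf_fm (star \<psi>)" "wf_fm (star \<phi>)"
    using wf_\<theta> wf_C \<theta> C wf_star by auto
  have G: "deriv T H (Imp (sh N \<theta>) \<theta>)" "deriv T H (Imp \<theta> (sh N \<theta>))" if "?G \<subseteq> H" for H
    using that wf_\<theta> by (auto intro!: Assm)
  have "deriv T ?G (Imp (star \<phi>) C)"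
  proof (rule ImpI_ext[OF wf(4)])
    fix H assume H: "?G \<subseteq> H" "deriv T H (star \<phi>)"
    show "deriv T H C"
      using star_imp_cl[OF wf(1) H(2), unfolded cl_def]
    proof (rule OrE_ext)
      fix K assume K: "H \<subseteq> K" "deriv T K (Imp \<theta> (sh N \<phi>))"
      \<comment> \<open>Here \<open>\<theta>\<close> is refuted: it implies
        \<open>sh N \<phi>\<close> and, through the assumption, its negation. The implication is
        vacuous, so \<open>x\<close> itself witnesses \<open>C\<close>.\<close>
      have "deriv T K (Imp \<theta> \<psi>)"
      proof (rule ImpI_ext[OF wf_\<theta>])
        fix L assume L: "K \<subseteq> L" "deriv T L \<theta>"
        have "deriv T L (sh N \<theta>)"
          using G(2)[of L] H(1) K(1) L by (blast intro: ImpE)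
        then have "deriv T L (Imp (sh N \<phi>) Bot)"
          by (simp add: \<theta>)
        moreover have "deriv T L (sh N \<phi>)"
          using ImpE[OF Weaken[OF K(2) L(1)] L(2)] .
        ultimately show "deriv T L \<psi>"
          using wf(2) by (meson BotE ImpE)
      qed
      then show "deriv T K C"
        unfolding C by (rule ExI_same)
    qed
  qed
  moreover have "star \<theta> = And (Imp (star \<phi>) C) (cl (sh N \<theta>))"
    using star.simps(5)[of \<phi> Bot] unfolding \<theta>[symmetric] by simp
  ultimately have "deriv T ?G (star \<theta>)"
    using AndI cl_Imp_\<theta>[OF G(2)] by simp
  moreover have "deriv T ?G (Imp (star \<theta>) (star (Ex x \<psi>)))"
    using star_ImpD[OF star_sound[OF ip]] deriv_lift by auto
  ultimately have "deriv T ?G (Ex (N + x) (star \<psi>))"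
    using ImpE[of T ?G "star \<theta>" "star (Ex x \<psi>)"] by simp
  then show ?thesis
  proof (rule ExE)
    \<comment> \<open>The side condition on \<open>x\<close> enters here: the eigenvariable
      \<open>N + x\<close> must be absent from the bridging assumptions.\<close>
    have fresh: "N + x \<notin> fv (sh N \<theta>)"
      using x by (rule shift_notin_fv_sh)
    then show "\<forall>B\<in>?G. N + x \<notin> fv B"
      by simp
    show "N + x \<notin> fv (Or C (sh N C))"
      by (simp add: C[THEN arg_cong[of _ _ "sh N"]])
    let ?H = "insert (star \<psi>) ?G"
    show "deriv T ?H (Or C (sh N C))"
      using star_imp_cl[OF wf(2) deriv_hyp[OF wf(3), of T ?G], unfolded cl_def]
    proof (rule OrE_ext)
      fix K assume K: "?H \<subseteq> K"
      show "deriv T K (Or C (sh N C))" if "deriv T K C"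
        using that wf_C by (intro OrI1) auto
      assume \<psi>: "deriv T K (Imp \<theta> (sh N \<psi>))"
      have "deriv T K (Imp (sh N \<theta>) (sh N \<psi>))"
      proof (rule ImpI_ext)
        fix L assume L: "K \<subseteq> L" "deriv T L (sh N \<theta>)"
        have "deriv T L (Imp (sh N \<theta>) \<theta>)"
          using K L(1) by (intro G(1)) auto
        from ImpE[OF this L(2)] show "deriv T L (sh N \<psi>)"
          using ImpE[OF Weaken[OF \<psi> L(1)]] by blast
      qed (use wf_\<theta> in auto)
      from ExI_same[OF this, of "N + x"] show "deriv T K (Or C (sh N C))"
        using wf_C by (intro OrI2) (auto simp: C)
    qed
  qed
qed

text \<open>The free variables are restored one at a time: substituting \<open>n\<close> for
  \<open>N + n\<close> turns \<open>f n\<close> into \<open>f (Suc n)\<close> and spares the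
  unshifted \<open>\<theta>\<close> and \<open>C\<close>, whose variables lie below
  \<open>N\<close>. The assumptions are written as implications so that \<open>deriv_subst\<close>
  applies.\<close>

lemma ip_unshift_free:
  assumes vars: "vars \<theta> \<subseteq> {..<N}" "vars C \<subseteq> {..<N}" and "n \<le> N"
    and "deriv T {} (Imp (Imp \<theta> (sh N \<theta>)) (Imp (Imp (sh N \<theta>) \<theta>) (Or C (sh N C))))"
  defines "f \<equiv> \<lambda>n v. if v < n then v else N + v"
  shows "deriv T {} (Imp (Imp \<theta> (rn N (f n) \<theta>)) (Imp (Imp (rn N (f n) \<theta>) \<theta>) (Or C (rn N (f n) C))))"
  using assms(3)
proof (induction n)
  case 0
  have "f 0 = (+) N"
    by (auto simp: f_def)
  then show ?case
    using assms(4) by simp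
next
  case (Suc n)
  have f: "\<And>u. f n u \<in> {u, N + u}" "f n n = N + n" "(f n)(n := n) = f (Suc n)" and n: "n < N"
    using Suc.prems by (auto simp: f_def)
  have "N + n \<notin> fv \<theta>" "N + n \<notin> fv C"
    using vars fv_subset_vars by fastforce+
  moreover have "subst (N + n) (Var n) (rn N (f n) A) = rn N (f (Suc n)) A"
    "free_for (Var n) (N + n) (rn N (f n) A)" if "vars A \<subseteq> {..<N}" for A
    using subst_rn[OF that f(1) n, where w = n] free_for_rn[OF that f(1) n, where w = n] f(2,3) by auto
  ultimately show ?case
    using deriv_subst[OF Suc.IH, of "Var n" "N + n"] vars n by (simp add: subst_fresh free_for_fresh)
qed

theorem theorem8p4:
  fixes k :: nat and \<phi> \<psi> :: fm and x :: nat
  assumes "wf_fm \<phi>" and "wf_fm \<psi>"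
    and "x \<notin> fv (Neg \<phi>)"
    and "HA \<union> LEM (Sigma_fm k) \<turnstile> Imp (Neg \<phi>) (Ex x \<psi>)"
  shows "HA \<union> LEM (Sigma_fm k) \<turnstile> Ex x (Imp (Neg \<phi>) \<psi>)"
proof -
  let ?T = "HAL k"
  define \<theta> where "\<theta> = Neg \<phi>"
  define C where "C = Ex x (Imp \<theta> \<psi>)"
  obtain N where "\<forall>v\<in>vars C. v < N"
    using finite_nat_set_iff_bounded finite_vars by metis
  then have vars: "vars C \<subseteq> {..<N}" "vars \<theta> \<subseteq> {..<N}"
    by (auto simp: C_def)
  have wf: "wf_fm C" "wf_fm \<theta>"
    using assms(1,2) by (auto simp: C_def \<theta>_def)
  have "glueing N \<theta> C"
    using wf vars fv_subset_vars by unfold_locales (blast intro: subset_trans)+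
  then have "deriv ?T {Imp (sh N \<theta>) \<theta>, Imp \<theta> (sh N \<theta>)} (Or C (sh N C))"
    using assms(3,4) by (intro ip_shifted[OF \<theta>_def C_def]) (auto simp: \<theta>_def provable_def)
  then have "deriv ?T {} (Imp (Imp \<theta> (sh N \<theta>)) (Imp (Imp (sh N \<theta>) \<theta>) (Or C (sh N C))))"
    using wf by (intro ImpI) auto
  \<comment> \<open>At \<open>n = N\<close> the renaming fixes all variables of
    \<open>\<theta>\<close> and \<open>C\<close>, so only bound names still differ: both bridging
    implications become provable, and both disjuncts amount to \<open>C\<close>.\<close>
  note ip_unshift_free[OF vars(2,1) order_refl this]
  moreover define f where "f v = (if v < N then v else N + v)" for v
  ultimately have
    "deriv ?T {} (Imp (Imp \<theta> (rn N f \<theta>)) (Imp (Imp (rn N f \<theta>) \<theta>) (Or C (rn N f C))))"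
    by (simp add: f_def[abs_def])
  moreover have f: "\<And>u. f u \<in> {u, N + u}" "\<And>u. u < N \<Longrightarrow> f u = u"
    by (auto simp: f_def)
  have "deriv ?T {} (Imp \<theta> (rn N f \<theta>))" "deriv ?T {} (Imp (rn N f \<theta>) \<theta>)"
    using deriv_rename_bound[OF wf(2) vars(2) f] wf by (auto intro: ImpI)
  ultimately have "deriv ?T {} (Or C (rn N f C))"
    by (meson ImpE)
  then have "deriv ?T {} C"
    using deriv_rename_bound[OF wf(1) vars(1) f] deriv_trans by (blast intro: OrE_ext)
  then show ?thesis
    by (simp add: provable_def C_def \<theta>_def)
qed

end
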